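(* Let $G$ be a group with identity element $e$ and let $R$ be a unital $G$-graded ring whose $G$-grading is non-degenerate. If $N$ is a normal subgroup of $G$ and $R_e$ is a domain, then the following assertions hold: (i) If $R_N:=\oplus_{n\in N}R_n$ is a domain and $G/N$ is a unique product group, then $R$ is a domain. (ii) Suppose that $N$ is torsion-free, that $G/N$ is a unique product group, and that every unit in $R$ which is contained in $R_{gN}:=\oplus_{h\in gN}R_h$, for some $g\in G$, must be homogeneous with respect to the $G$-grading. Then every unit in $R$ is homogeneous with respect to the $G$-grading.
   Context: Rings are associative, not necessarily commutative. A ring $R$ is $G$-graded if there is a collection $\{R_g\}_{g\in G}$ of additive subgroups of $R$ such that $R=\oplus_{g\in G}R_g$ and $R_gR_h\subseteq R_{gh}$ for all $g,h\in G$. A nonzero element of $R$ is homogeneous with respect to the $G$-grading if it belongs to $R_g$ for some $g\in G$. The $G$-grading is non-degenerate if, for each $g\in G$ and each nonzero $r_g\in R_g$, we have $r_gR_{g^{-1}}\neq\{0\}$ and $R_{g^{-1}}r_g\neq\{0\}$. A domain is a nonzero (not necessarily commutative) ring in which the product of any two nonzero elements is nonzero. A group $\Gamma$ is a unique product group if, given any two non-empty finite subsets $A$ and $B$ of $\Gamma$, there exists at least one element $g\in\Gamma$ which has a unique representation of the form $g=ab$ with $a\in A$ and $b\in B$. *)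

theory Defs
  imports "HOL-Algebra.Algebra"
begin

text \<open>
  Domains need not be commutative, so \<^locale>\<open>domain\<close> does not apply. No identity element is
  required, so that the predicate can be applied to a graded part of a ring without
  presupposing that this part contains the identity.
\<close>

locale nc_domain = abelian_group R for R (structure) +
  assumes mult_closed: "\<lbrakk> x \<in> carrier R; y \<in> carrier R \<rbrakk> \<Longrightarrow> x \<otimes> y \<in> carrier R"
    and mult_assoc: "\<lbrakk> x \<in> carrier R; y \<in> carrier R; z \<in> carrier R \<rbrakk>
        \<Longrightarrow> (x \<otimes> y) \<otimes> z = x \<otimes> (y \<otimes> z)"
    and distrib_right: "\<lbrakk> x \<in> carrier R; y \<in> carrier R; z \<in> carrier R \<rbrakk>
        \<Longrightarrow> (x \<oplus> y) \<otimes> z = x \<otimes> z \<oplus> y \<otimes> z"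
    and distrib_left: "\<lbrakk> x \<in> carrier R; y \<in> carrier R; z \<in> carrier R \<rbrakk>
        \<Longrightarrow> z \<otimes> (x \<oplus> y) = z \<otimes> x \<oplus> z \<otimes> y"
    and nonzero: "carrier R \<noteq> {\<zero>}"
    and no_zero_divisors: "\<lbrakk> x \<in> carrier R; y \<in> carrier R; x \<noteq> \<zero>; y \<noteq> \<zero> \<rbrakk> \<Longrightarrow> x \<otimes> y \<noteq> \<zero>"

text \<open>
  The external direct sum of the family \<open>S\<close> over \<open>H\<close>: families of finite support, made
  extensional so that a family is determined by its values on \<open>H\<close>. The summation map adds over
  the support because \<^const>\<open>finsum\<close> over an infinite index set is the zero of the ring.
\<close>

definition finsupp_families ::
    "('r, 'k) ring_scheme \<Rightarrow> ('g \<Rightarrow> 'r set) \<Rightarrow> 'g set \<Rightarrow> ('g \<Rightarrow> 'r) set"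
  where "finsupp_families R S H = {f \<in> (\<Pi>\<^sub>E h\<in>H. S h). finite {h \<in> H. f h \<noteq> \<zero>\<^bsub>R\<^esub>}}"

definition family_sum :: "('r, 'k) ring_scheme \<Rightarrow> 'g set \<Rightarrow> ('g \<Rightarrow> 'r) \<Rightarrow> 'r"
  where "family_sum R H f = (\<Oplus>\<^bsub>R\<^esub>h\<in>{h \<in> H. f h \<noteq> \<zero>\<^bsub>R\<^esub>}. f h)"

locale graded_ring = G: group G + R: ring R
  for G :: "('g, 'm) monoid_scheme" and R :: "('r, 'k) ring_scheme" and S :: "'g \<Rightarrow> 'r set" +
  assumes component_subgroup: "g \<in> carrier G \<Longrightarrow> additive_subgroup (S g) R"
    and direct_sum:
      "bij_betw (family_sum R (carrier G)) (finsupp_families R S (carrier G)) (carrier R)"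
    and component_mult: "\<lbrakk> g \<in> carrier G; h \<in> carrier G; x \<in> S g; y \<in> S h \<rbrakk>
        \<Longrightarrow> x \<otimes>\<^bsub>R\<^esub> y \<in> S (g \<otimes>\<^bsub>G\<^esub> h)"

text \<open>\<open>graded_part R S H\<close> is the internal direct sum of the components \<open>S h\<close>, \<open>h \<in> H\<close>.\<close>

definition graded_part ::
    "('r, 'k) ring_scheme \<Rightarrow> ('g \<Rightarrow> 'r set) \<Rightarrow> 'g set \<Rightarrow> 'r set"
  where "graded_part R S H = family_sum R H ` finsupp_families R S H"

definition nondegenerate_grading ::
    "('g, 'm) monoid_scheme \<Rightarrow> ('r, 'k) ring_scheme \<Rightarrow> ('g \<Rightarrow> 'r set) \<Rightarrow> bool"
  where "nondegenerate_grading G R S \<longleftrightarrow>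
    (\<forall>g\<in>carrier G. \<forall>r\<in>S g. r \<noteq> \<zero>\<^bsub>R\<^esub> \<longrightarrow>
       (\<lambda>s. r \<otimes>\<^bsub>R\<^esub> s) ` S (inv\<^bsub>G\<^esub> g) \<noteq> {\<zero>\<^bsub>R\<^esub>} \<and>
       (\<lambda>s. s \<otimes>\<^bsub>R\<^esub> r) ` S (inv\<^bsub>G\<^esub> g) \<noteq> {\<zero>\<^bsub>R\<^esub>})"

definition homogeneous ::
    "('g, 'm) monoid_scheme \<Rightarrow> ('r, 'k) ring_scheme \<Rightarrow> ('g \<Rightarrow> 'r set) \<Rightarrow> 'r \<Rightarrow> bool"
  where "homogeneous G R S r \<longleftrightarrow> r \<noteq> \<zero>\<^bsub>R\<^esub> \<and> (\<exists>g\<in>carrier G. r \<in> S g)"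

definition unique_product_group :: "('g, 'm) monoid_scheme \<Rightarrow> bool"
  where "unique_product_group G \<longleftrightarrow> group G \<and>
    (\<forall>A B. A \<subseteq> carrier G \<and> B \<subseteq> carrier G \<and> finite A \<and> finite B \<and> A \<noteq> {} \<and> B \<noteq> {} \<longrightarrow>
       (\<exists>g\<in>carrier G. \<exists>!p. p \<in> A \<times> B \<and> g = fst p \<otimes>\<^bsub>G\<^esub> snd p))"

definition torsion_free_group :: "('g, 'm) monoid_scheme \<Rightarrow> bool"
  where "torsion_free_group G \<longleftrightarrow> group G \<and>
    (\<forall>x\<in>carrier G. \<forall>n::nat. n > 0 \<and> x [^]\<^bsub>G\<^esub> n = \<one>\<^bsub>G\<^esub> \<longrightarrow> x = \<one>\<^bsub>G\<^esub>)"

end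

theory Submission
  imports Defs
begin

text \<open>
  The ring is coarsened to a grading by \<open>G/N\<close>, with components \<open>R\<^bsub>C\<^esub>\<close> for the cosets \<open>C\<close>. If
  \<open>R\<^bsub>N\<^esub>\<close> has no zero divisors, then neither do products of elements that are homogeneous for this
  coarse grading: for non-zero \<open>a\<close> in \<open>R\<^bsub>C\<^esub>\<close> and \<open>b\<close> in \<open>R\<^bsub>D\<^esub>\<close>, non-degeneracy provides homogeneous
  \<open>s\<close> and \<open>t\<close> such that \<open>sa\<close> and \<open>bt\<close> are non-zero elements of \<open>R\<^bsub>N\<^esub>\<close>, and \<open>(sa)(bt)\<close> vanishes
  if \<open>ab\<close> does (\<open>coset_homogeneous_mult_nonzero\<close>). A pair of cosets \<open>C\<close>, \<open>D\<close> whose product is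
  represented only once among the cosets that meet the supports of \<open>a\<close> and \<open>b\<close> therefore contributes
  to \<open>ab\<close> a part in the coset \<open>CD\<close> that nothing cancels (\<open>coset_unique_factors_support\<close>).

  For (i) this is the whole argument, since a unique product group supplies such a pair. For (ii),
  let \<open>uv = 1\<close>. By Strojnowski's theorem (\<open>two_unique_products\<close>), unless \<open>u\<close> and \<open>v\<close> each meet just
  one coset there are two such pairs, hence two distinct cosets meeting the support of \<open>1\<close>, which
  consists of the identity of \<open>G\<close>. So \<open>u\<close> lies in a single \<open>R\<^bsub>gN\<^esub>\<close>, where units are homogeneous by
  assumption.

  What remains for (ii) is that \<open>R\<^bsub>N\<^esub>\<close> has no zero divisors when \<open>N\<close> is torsion-free and the units
  in \<open>R\<^bsub>N\<^esub>\<close> are homogeneous (\<open>torsion_free_part_no_zero_divisors\<close>). The ring \<open>R\<^bsub>N\<^esub>\<close> is reduced, because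
  \<open>x\<^sup>2 = 0\<close> makes \<open>1 + x\<close> a unit, and torsion-freeness leaves no room for it to be homogeneous unless
  \<open>x = 0\<close>. In a reduced ring \<open>ab = 0\<close> forces \<open>arb = 0\<close> for every \<open>r\<close>. So the claim follows from
  primeness of \<open>R\<^bsub>N\<^esub>\<close>, which rests on a statement about groups: in a torsion-free group, finite non-empty
  sets \<open>A\<close> and \<open>B\<close> admit an \<open>x\<close> such that \<open>Ax\<close> and \<open>B\<close> have a unique product
  (\<open>torsion_free_unique_factors_insert\<close>). Applied to the supports of \<open>a\<close> and \<open>b\<close>, with \<open>r\<close> homogeneous
  of degree \<open>x\<close>, it gives \<open>arb\<close> a non-zero component.

  The group statement is the combinatorial core of Connell's theorem on prime group rings. The elements
  with finitely many conjugates form a subgroup, which in the torsion-free case is abelian by a transfer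
  argument, hence orderable on finite sets, hence has unique products. An \<open>x\<close> that centralizes the
  part of \<open>A\<close> in this subgroup and moves the rest of \<open>A\<close> away from finitely many forbidden elements
  exists by B. H. Neumann's covering argument (\<open>conjugate_avoiding_finite\<close>).
\<close>

section \<open>Unique products in groups\<close>

definition unique_factors :: "('g, 'm) monoid_scheme \<Rightarrow> 'g set \<Rightarrow> 'g set \<Rightarrow> 'g \<Rightarrow> 'g \<Rightarrow> bool"
  where "unique_factors M A B a b \<longleftrightarrow> a \<in> A \<and> b \<in> B \<and>
    (\<forall>a'\<in>A. \<forall>b'\<in>B. a' \<otimes>\<^bsub>M\<^esub> b' = a \<otimes>\<^bsub>M\<^esub> b \<longrightarrow> a' = a \<and> b' = b)"

lemma unique_product_group_unique_factors:
  assumes "unique_product_group M" "A \<subseteq> carrier M" "B \<subseteq> carrier M" "finite A" "finite B"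
    "A \<noteq> {}" "B \<noteq> {}"
  obtains a b where "unique_factors M A B a b"
proof -
  have "\<exists>g\<in>carrier M. \<exists>!p. p \<in> A \<times> B \<and> g = fst p \<otimes>\<^bsub>M\<^esub> snd p"
    by (rule assms(1)[unfolded unique_product_group_def, THEN conjunct2, rule_format])
      (simp add: assms)
  then obtain g where "\<exists>!p. p \<in> A \<times> B \<and> g = fst p \<otimes>\<^bsub>M\<^esub> snd p"
    by (elim bexE)
  then obtain p where p: "p \<in> A \<times> B" "g = fst p \<otimes>\<^bsub>M\<^esub> snd p"
    and uniq: "\<And>q. q \<in> A \<times> B \<Longrightarrow> g = fst q \<otimes>\<^bsub>M\<^esub> snd q \<Longrightarrow> q = p"
    by blast
  have "a' = fst p \<and> b' = snd p"
    if "a' \<in> A" "b' \<in> B" "a' \<otimes>\<^bsub>M\<^esub> b' = fst p \<otimes>\<^bsub>M\<^esub> snd p" for a' b'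
    using uniq[of "(a', b')"] that p by force
  with p have "unique_factors M A B (fst p) (snd p)"
    unfolding unique_factors_def by auto
  then show thesis by (rule that)
qed

context group
begin

lemma inv_mult_cancel [simp]: "x \<in> carrier G \<Longrightarrow> y \<in> carrier G \<Longrightarrow> inv x \<otimes> (x \<otimes> y) = y"
  by (simp flip: m_assoc)

lemma mult_inv_cancel [simp]: "x \<in> carrier G \<Longrightarrow> y \<in> carrier G \<Longrightarrow> x \<otimes> (inv x \<otimes> y) = y"
  by (simp flip: m_assoc)

lemma unique_factors_translate:
  assumes A: "A \<subseteq> carrier G" and B: "B \<subseteq> carrier G" and c: "c \<in> carrier G" and d: "d \<in> carrier G"
    and ab: "a \<in> carrier G" "b \<in> carrier G"
  shows "unique_factors G ((\<lambda>x. c \<otimes> x) ` A) ((\<lambda>y. y \<otimes> d) ` B) (c \<otimes> a) (b \<otimes> d)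
    \<longleftrightarrow> unique_factors G A B a b"
proof -
  have eq: "(c \<otimes> x) \<otimes> (y \<otimes> d) = (c \<otimes> a) \<otimes> (b \<otimes> d) \<longleftrightarrow> x \<otimes> y = a \<otimes> b"
    if "x \<in> carrier G" "y \<in> carrier G" for x y
  proof -
    have "(c \<otimes> x) \<otimes> (y \<otimes> d) = c \<otimes> (x \<otimes> y) \<otimes> d" "(c \<otimes> a) \<otimes> (b \<otimes> d) = c \<otimes> (a \<otimes> b) \<otimes> d"
      using that c d ab by (simp_all add: m_assoc)
    then show ?thesis using that c d ab by simp
  qed
  have mem: "c \<otimes> a \<in> (\<lambda>x. c \<otimes> x) ` A \<longleftrightarrow> a \<in> A" "b \<otimes> d \<in> (\<lambda>y. y \<otimes> d) ` B \<longleftrightarrow> b \<in> B"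
    using A B c d ab by (auto simp: image_iff subset_iff)
  show ?thesis
    unfolding unique_factors_def mem using A B c d ab
    by (auto simp: subset_iff eq)
qed

text \<open>
  Strojnowski's theorem. After translation, a sole unique product is \<open>\<one> \<otimes> \<one>\<close>. The sets
  \<open>C = B\<inverse> A\<close> and \<open>D = B A\<inverse>\<close> then have no unique product at all: in \<open>y1\<inverse> x1 y2 x2\<inverse>\<close> the inner factor
  \<open>x1 y2\<close> can be rewritten unless \<open>x1 = y2 = \<one>\<close>, the outer one, which is the inverse of \<open>x2 y1\<close>, can
  then be rewritten unless \<open>x2 = y1 = \<one>\<close>, and finally \<open>\<one>\<close> is also \<open>x x\<inverse>\<close> or \<open>y\<inverse> y\<close> for an
  element other than \<open>\<one>\<close> of one of the two sets.
\<close>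

lemma two_unique_products:
  assumes up: "unique_product_group G"
    and A: "A \<subseteq> carrier G" "finite A" and B: "B \<subseteq> carrier G" "finite B"
    and large: "(\<exists>x\<in>A. \<exists>y\<in>A. x \<noteq> y) \<or> (\<exists>x\<in>B. \<exists>y\<in>B. x \<noteq> y)"
    and ab: "unique_factors G A B a b"
  obtains a' b' where "unique_factors G A B a' b'" "(a', b') \<noteq> (a, b)"
proof (rule ccontr)
  assume "\<not> thesis"
  with that have only: "\<And>x y. unique_factors G A B x y \<Longrightarrow> x = a \<and> y = b" by blast
  have abc: "a \<in> carrier G" "b \<in> carrier G" using ab A B by (auto simp: unique_factors_def)
  define A' where "A' = (\<lambda>x. inv a \<otimes> x) ` A"
  define B' where "B' = (\<lambda>y. y \<otimes> inv b) ` B"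
  have A': "A' \<subseteq> carrier G" "finite A'" and B': "B' \<subseteq> carrier G" "finite B'"
    using A B abc by (auto simp: A'_def B'_def)
  have one: "\<one> \<in> A'" "\<one> \<in> B'"
    using ab abc image_eqI[of \<one> "\<lambda>x. inv a \<otimes> x" a A] image_eqI[of \<one> "\<lambda>y. y \<otimes> inv b" b B]
    by (simp_all add: A'_def B'_def unique_factors_def)
  have only': "x = \<one> \<and> y = \<one>" if uf: "unique_factors G A' B' x y" for x y
  proof -
    obtain x0 y0 where xy: "x0 \<in> A" "y0 \<in> B" "x = inv a \<otimes> x0" "y = y0 \<otimes> inv b"
      using uf unfolding unique_factors_def A'_def B'_def by blast
    moreover have "x0 \<in> carrier G" "y0 \<in> carrier G" using xy A B by auto
    ultimately have "unique_factors G A B x0 y0"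
      using uf A(1) B(1) abc unique_factors_translate[of A B "inv a" "inv b" x0 y0]
      by (simp add: A'_def B'_def)
    with only xy abc show ?thesis by simp
  qed
  have other: "\<exists>x'\<in>A'. \<exists>y'\<in>B'. x' \<otimes> y' = x \<otimes> y \<and> (x', y') \<noteq> (x, y)"
    if "x \<in> A'" "y \<in> B'" "(x, y) \<noteq> (\<one>, \<one>)" for x y
    using only'[of x y] that unfolding unique_factors_def by blast
  define C where "C = (\<lambda>(y, x). inv y \<otimes> x) ` (B' \<times> A')"
  define D where "D = (\<lambda>(y, x). y \<otimes> inv x) ` (B' \<times> A')"
  have "C \<subseteq> carrier G" "D \<subseteq> carrier G" "finite C" "finite D" "C \<noteq> {}" "D \<noteq> {}"
    using A' B' one by (auto simp: C_def D_def)
  then obtain u v where uv: "unique_factors G C D u v"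
    using unique_product_group_unique_factors[OF up] by metis
  then obtain y1 x1 y2 x2 where els: "y1 \<in> B'" "x1 \<in> A'" "y2 \<in> B'" "x2 \<in> A'"
    and u: "u = inv y1 \<otimes> x1" and v: "v = y2 \<otimes> inv x2"
    by (auto simp: unique_factors_def C_def D_def)
  have carr: "y1 \<in> carrier G" "x1 \<in> carrier G" "y2 \<in> carrier G" "x2 \<in> carrier G"
    using els A' B' by auto
  have uniq: "inv y \<otimes> x = u \<and> y' \<otimes> inv x' = v"
    if "y \<in> B'" "x \<in> A'" "y' \<in> B'" "x' \<in> A'" "inv y \<otimes> x \<otimes> (y' \<otimes> inv x') = u \<otimes> v" for y x y' x'
  proof -
    have "inv y \<otimes> x \<in> C" "y' \<otimes> inv x' \<in> D"
      using that by (auto simp: C_def D_def)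
    with uv that(5) show ?thesis by (auto simp: unique_factors_def)
  qed
  have inner: "x1 = \<one> \<and> y2 = \<one>"
  proof (rule ccontr)
    assume "\<not> ?thesis"
    then obtain x y where xy: "x \<in> A'" "y \<in> B'" "x \<otimes> y = x1 \<otimes> y2" "(x, y) \<noteq> (x1, y2)"
      using other[of x1 y2] els by auto
    have c: "x \<in> carrier G" "y \<in> carrier G" using xy A' B' by auto
    have "inv y1 \<otimes> x \<otimes> (y \<otimes> inv x2) = inv y1 \<otimes> (x \<otimes> y) \<otimes> inv x2"
      using carr c by (simp add: m_assoc)
    also have "\<dots> = u \<otimes> v" unfolding xy(3) u v using carr by (simp add: m_assoc)
    finally have "inv y1 \<otimes> x = u \<and> y \<otimes> inv x2 = v"
      by (rule uniq[OF els(1) xy(1) xy(2) els(4)])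
    then show False using xy(4) carr c by (simp add: u v)
  qed
  have outer: "x2 = \<one> \<and> y1 = \<one>"
  proof (rule ccontr)
    assume "\<not> ?thesis"
    then obtain x y where xy: "x \<in> A'" "y \<in> B'" "x \<otimes> y = x2 \<otimes> y1" "(x, y) \<noteq> (x2, y1)"
      using other[of x2 y1] els by auto
    have c: "x \<in> carrier G" "y \<in> carrier G" using xy A' B' by auto
    have "inv y \<otimes> \<one> \<otimes> (\<one> \<otimes> inv x) = inv (x \<otimes> y)"
      using c by (simp add: inv_mult_group)
    also have "\<dots> = u \<otimes> v"
      unfolding xy(3) u v using carr inner by (simp add: inv_mult_group)
    finally have "inv y \<otimes> \<one> = u \<and> \<one> \<otimes> inv x = v"
      by (rule uniq[OF xy(2) one(1) one(2) xy(1)])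
    then have "inv y = inv y1" "inv x = inv x2" using inner carr c by (simp_all add: u v)
    then have "y = y1" "x = x2" using carr c inv_inv by metis+
    then show False using xy(4) by simp
  qed
  have uv1: "u = \<one>" "v = \<one>" using inner outer by (simp_all add: u v)
  \<comment> \<open>A second element of either set represents \<open>\<one>\<close> in \<open>C D\<close> by a pair other than \<open>(\<one>, \<one>)\<close>.\<close>
  from large consider x where "x \<in> A'" "x \<noteq> \<one>" | y where "y \<in> B'" "y \<noteq> \<one>"
  proof
    assume "\<exists>x\<in>A. \<exists>y\<in>A. x \<noteq> y"
    then obtain x where x: "x \<in> A" "x \<noteq> a" by metis
    then have "inv a \<otimes> x \<in> A'" "inv a \<otimes> x \<noteq> \<one>"
      using A abc inv_solve_left'[of \<one> a x] by (auto simp: A'_def)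
    then show thesis using that by blast
  next
    assume "\<exists>x\<in>B. \<exists>y\<in>B. x \<noteq> y"
    then obtain y where y: "y \<in> B" "y \<noteq> b" by metis
    then have "y \<otimes> inv b \<in> B'" "y \<otimes> inv b \<noteq> \<one>"
      using B abc inv_solve_right'[of \<one> y b] by (auto simp: B'_def)
    then show thesis using that by blast
  qed
  then show False
  proof cases
    case 1
    then have "x \<in> carrier G" using A' by auto
    then show ?thesis using uniq[of \<one> x \<one> x] 1 one uv1 by simp
  next
    case 2
    then have "y \<in> carrier G" using B' by auto
    then show ?thesis using uniq[of y \<one> y \<one>] 2 one uv1 by simp
  qed
qed

end

section \<open>Torsion-free abelian groups\<close>

text \<open>
  A torsion-free abelian group is orderable, and this is the finite approximation that suffices: \<open>P\<close>
  is the set of positive elements of an order deciding the sign of each member of \<open>Y\<close>. A new element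
  \<open>x\<close> can be adjoined to \<open>P\<close> with one of its two signs. Otherwise \<open>p x\<^sup>n = \<one>\<close> and \<open>q = x\<^sup>m\<close> for some
  \<open>p\<close>, \<open>q\<close> in the cone or equal to \<open>\<one>\<close> and positive \<open>n\<close>, \<open>m\<close>, whence \<open>p\<^sup>m q\<^sup>n = \<one>\<close>. Here \<open>p \<noteq> \<one>\<close> by
  torsion-freeness, so \<open>\<one>\<close> would lie in \<open>P\<close>.
\<close>

lemma (in comm_group) torsion_free_finite_positive_cone:
  assumes tf: "torsion_free_group G" and "finite Y" "Y \<subseteq> carrier G - {\<one>}"
  shows "\<exists>P\<subseteq>carrier G. \<one> \<notin> P \<and> (\<forall>p\<in>P. \<forall>q\<in>P. p \<otimes> q \<in> P) \<and> (\<forall>x\<in>Y. x \<in> P \<or> inv x \<in> P)"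
  using assms(2,3)
proof (induction Y)
  case empty
  then show ?case by (intro exI[of _ "{}"]) auto
next
  case (insert x Y)
  then have "Y \<subseteq> carrier G - {\<one>}" by simp
  from insert.IH[OF this] obtain P
    where P: "P \<subseteq> carrier G" "\<one> \<notin> P" "\<And>p q. p \<in> P \<Longrightarrow> q \<in> P \<Longrightarrow> p \<otimes> q \<in> P"
      and PY: "\<forall>x\<in>Y. x \<in> P \<or> inv x \<in> P" by blast
  have x: "x \<in> carrier G" "x \<noteq> \<one>" using insert.prems by auto
  define P1 where "P1 = insert \<one> P"
  have P1: "P1 \<subseteq> carrier G" "\<one> \<in> P1" "\<And>p q. p \<in> P1 \<Longrightarrow> q \<in> P1 \<Longrightarrow> p \<otimes> q \<in> P1"
    using P by (auto simp: P1_def)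
  have P1_P: "p \<otimes> q \<in> P" if "p \<in> P" "q \<in> P1" for p q
    using that P by (auto simp: P1_def)
  have P1_pow: "p [^] (n::nat) \<in> P1" if "p \<in> P1" for p n
    by (induction n) (use that P1 in auto)
  \<comment> \<open>The semigroup generated by \<open>P\<close> and \<open>y\<close>; it is used with \<open>y = x\<close> and \<open>y = inv x\<close>.\<close>
  define Q where "Q y = P \<union> {p \<otimes> y [^] n | p n. p \<in> P1 \<and> n > (0::nat)}" for y
  have Q_intro: "p \<otimes> y [^] n \<in> Q y" if "p \<in> P1" "n > (0::nat)" for p y n
    using that unfolding Q_def by blast
  have ext: ?case if y: "y \<in> carrier G" "y = x \<or> y = inv x"
    and y1: "\<And>p n. p \<in> P1 \<Longrightarrow> n > (0::nat) \<Longrightarrow> p \<otimes> y [^] n \<noteq> \<one>" for y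
  proof (intro exI conjI)
    show "Q y \<subseteq> carrier G" using P P1 y by (auto simp: Q_def)
    show "\<one> \<notin> Q y"
    proof
      assume "\<one> \<in> Q y"
      then obtain p n where "p \<in> P1" "n > (0::nat)" "p \<otimes> y [^] n = \<one>"
        using P(2) unfolding Q_def by fastforce
      with y1 show False by blast
    qed
    have QP: "p \<otimes> q \<in> Q y" if "p \<in> P" "q \<in> Q y" for p q
    proof -
      consider "q \<in> P" | r n where "r \<in> P1" "n > (0::nat)" "q = r \<otimes> y [^] n"
        using \<open>q \<in> Q y\<close> by (auto simp: Q_def)
      then show ?thesis
      proof cases
        case 1 then show ?thesis using P that by (auto simp: Q_def)
      next
        case 2
        then have "p \<otimes> q = (p \<otimes> r) \<otimes> y [^] n" "p \<otimes> r \<in> P1"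
          using P P1 that y P1_P[of p r] by (auto simp: m_assoc P1_def subset_iff)
        with 2 show ?thesis using Q_intro by simp
      qed
    qed
    have QQ: "p \<otimes> q \<in> Q y" if pq: "p \<in> Q y" "q \<in> Q y" for p q
    proof -
      have c: "p \<in> carrier G" "q \<in> carrier G" using pq \<open>Q y \<subseteq> carrier G\<close> by auto
      consider "p \<in> P" | "q \<in> P" | r n s m where "r \<in> P1" "n > (0::nat)" "p = r \<otimes> y [^] n"
          "s \<in> P1" "m > (0::nat)" "q = s \<otimes> y [^] m"
        using pq unfolding Q_def by blast
      then show ?thesis
      proof cases
        case 1 then show ?thesis using QP pq by blast
      next
        case 2 then show ?thesis using QP[of q p] pq m_comm[OF c] by simp
      next
        case 3
        have "r \<in> carrier G" "s \<in> carrier G" using 3 P1 by auto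
        then have "p \<otimes> q = (r \<otimes> s) \<otimes> y [^] (n + m)"
          using 3 y by (simp add: m_ac flip: nat_pow_mult)
        moreover have "r \<otimes> s \<in> P1" "n + m > 0" using 3 P1 by simp_all
        ultimately show ?thesis using Q_intro by metis
      qed
    qed
    show "\<forall>p\<in>Q y. \<forall>q\<in>Q y. p \<otimes> q \<in> Q y" using QQ by blast
    have "y \<in> Q y" using Q_intro[OF P1(2), of 1 y] y(1) by simp
    then have "x \<in> Q y \<or> inv x \<in> Q y" using y(2) by auto
    moreover have "\<forall>z\<in>Y. z \<in> Q y \<or> inv z \<in> Q y" using PY by (auto simp: Q_def)
    ultimately show "\<forall>z\<in>insert x Y. z \<in> Q y \<or> inv z \<in> Q y" by simp
  qed
  show ?case
  proof (cases "\<exists>p\<in>P1. \<exists>n>(0::nat). p \<otimes> x [^] n = \<one>")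
    case False
    then show ?thesis using ext[of x] x(1) by blast
  next
    case True
    then obtain p n where pn: "p \<in> P1" "n > (0::nat)" "p \<otimes> x [^] n = \<one>" by blast
    have "x [^] n \<noteq> \<one>" using tf x pn(2) unfolding torsion_free_group_def by blast
    then have pP: "p \<in> P" using pn x by (auto simp: P1_def)
    show ?thesis
    proof (rule ext[of "inv x"])
      fix q :: 'a and m :: nat assume q: "q \<in> P1" "m > 0"
      show "q \<otimes> inv x [^] m \<noteq> \<one>"
      proof
        assume "q \<otimes> inv x [^] m = \<one>"
        then have qm: "q = x [^] m" using q P1 x
          using inv_solve_right'[of \<one> q "x [^] m"] by (auto simp: nat_pow_inv subset_iff)
        have pc: "p \<in> carrier G" using pP P by auto
        have "p [^] m \<otimes> q [^] n = (p \<otimes> x [^] n) [^] m"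
          unfolding qm using x pc by (simp add: nat_pow_distrib nat_pow_pow mult.commute)
        then have eq: "p [^] m \<otimes> q [^] n = \<one>" using pn by simp
        obtain k where k: "m = Suc k" using q(2) gr0_implies_Suc by blast
        have "p [^] m \<in> P" unfolding k
          using P1_P[OF pP P1_pow[OF pn(1), of k]] pc m_comm by simp
        then have "p [^] m \<otimes> q [^] n \<in> P" using P1_P P1_pow q by blast
        with eq P(2) show False by simp
      qed
    qed (use x in auto)
  qed
qed

text \<open>
  The product of the two largest elements, for an order that is total on \<open>A\<close> and on \<open>B\<close>, has no other
  representation.
\<close>

lemma (in comm_group) torsion_free_unique_factors:
  assumes tf: "torsion_free_group G"
    and A: "A \<subseteq> carrier G" "finite A" "A \<noteq> {}" and B: "B \<subseteq> carrier G" "finite B" "B \<noteq> {}"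
  obtains a b where "unique_factors G A B a b"
proof -
  define Y where "Y = (\<lambda>(x, y). inv x \<otimes> y) ` (A \<times> A \<union> B \<times> B) - {\<one>}"
  have "finite Y" "Y \<subseteq> carrier G - {\<one>}"
    using A B by (auto simp: Y_def dest: subsetD intro!: m_closed)
  then obtain P where P: "P \<subseteq> carrier G" "\<one> \<notin> P" "\<And>p q. p \<in> P \<Longrightarrow> q \<in> P \<Longrightarrow> p \<otimes> q \<in> P"
    and PY: "\<And>x. x \<in> Y \<Longrightarrow> x \<in> P \<or> inv x \<in> P"
    using torsion_free_finite_positive_cone[OF tf] by meson
  define less where "less x y \<longleftrightarrow> inv x \<otimes> y \<in> P" for x y
  have trans: "less x z" if "less x y" "less y z" "x \<in> carrier G" "y \<in> carrier G" "z \<in> carrier G"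
    for x y z
    using P(3)[of "inv x \<otimes> y" "inv y \<otimes> z"] that by (simp add: less_def m_assoc)
  have asym: "\<not> less y x" if "less x y" "x \<in> carrier G" "y \<in> carrier G" for x y
    using trans[of x y x] that P(2) by (auto simp: less_def)
  have total: "less x y \<or> less y x" if "x \<noteq> y" "x \<in> A \<and> y \<in> A \<or> x \<in> B \<and> y \<in> B" for x y
  proof -
    have c: "x \<in> carrier G" "y \<in> carrier G" using that A B by auto
    have "inv x \<otimes> y \<noteq> \<one>" using c that(1) inv_solve_left'[of \<one> x y] by auto
    then have "inv x \<otimes> y \<in> Y" using that(2) by (auto simp: Y_def)
    then show ?thesis using PY[of "inv x \<otimes> y"] c by (auto simp: less_def inv_mult_group)
  qed
  have max: "\<exists>m\<in>C. \<forall>x\<in>C. x \<noteq> m \<longrightarrow> less x m" if "C = A \<or> C = B" for C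
  proof -
    have C: "finite C" "C \<noteq> {}" "C \<subseteq> carrier G" using that A B by auto
    have "asymp_on C less" using C asym by (intro asymp_onI) (simp add: subset_iff)
    moreover have "transp_on C less"
      by (rule transp_onI, rule trans) (use C in \<open>auto simp: subset_iff\<close>)
    ultimately obtain m where "m \<in> C" "\<forall>x\<in>C. x \<noteq> m \<longrightarrow> \<not> less m x"
      using Finite_Set.bex_max_element[of C less] C by blast
    with total that show ?thesis by metis
  qed
  obtain a b where a: "a \<in> A" "\<And>x. x \<in> A \<Longrightarrow> x \<noteq> a \<Longrightarrow> less x a"
    and b: "b \<in> B" "\<And>y. y \<in> B \<Longrightarrow> y \<noteq> b \<Longrightarrow> less y b"
    using max by metis
  have "x = a \<and> y = b" if xy: "x \<in> A" "y \<in> B" "x \<otimes> y = a \<otimes> b" for x y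
  proof (rule ccontr)
    assume neq: "\<not> ?thesis"
    have c: "x \<in> carrier G" "y \<in> carrier G" "a \<in> carrier G" "b \<in> carrier G"
      using xy a b A B by auto
    have "inv x \<otimes> a \<otimes> (inv y \<otimes> b) = inv (x \<otimes> y) \<otimes> (a \<otimes> b)"
      using c by (simp add: inv_mult m_ac)
    then have one: "inv x \<otimes> a \<otimes> (inv y \<otimes> b) = \<one>" using xy(3) c by simp
    have xa: "inv x \<otimes> a \<in> insert \<one> P" using a(2)[OF xy(1)] c by (cases "x = a") (auto simp: less_def)
    have yb: "inv y \<otimes> b \<in> insert \<one> P" using b(2)[OF xy(2)] c by (cases "y = b") (auto simp: less_def)
    have "inv x \<otimes> a \<in> P \<or> inv y \<otimes> b \<in> P"
      using neq a(2)[OF xy(1)] b(2)[OF xy(2)] by (auto simp: less_def)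
    then have "inv x \<otimes> a \<otimes> (inv y \<otimes> b) \<in> P"
      using xa yb P by (auto simp: subset_iff)
    with one P(2) show False by simp
  qed
  then have "unique_factors G A B a b" using a b by (auto simp: unique_factors_def)
  then show thesis by (rule that)
qed

section \<open>Transfer and the FC-centre of a torsion-free group\<close>

lemma (in group) torsion_free_subgroup:
  assumes "torsion_free_group G" "subgroup H G"
  shows "torsion_free_group (G\<lparr>carrier := H\<rparr>)"
proof -
  have "group (G\<lparr>carrier := H\<rparr>)" by (rule subgroup_imp_group[OF assms(2)])
  moreover have "x = \<one>" if "x \<in> H" "n > 0" "x [^] n = \<one>" for x and n :: nat
    using assms(1) that subgroup.mem_carrier[OF assms(2)]
    unfolding torsion_free_group_def by blast
  ultimately show ?thesis
    unfolding torsion_free_group_def by (simp flip: nat_pow_consistent) blast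
qed

text \<open>
  Schur's theorem in the torsion-free case, by transfer: \<open>V\<close> is a homomorphism into the abelian group \<open>Z\<close>
  and is the power map \<open>z \<mapsto> z\<^sup>n\<close> on \<open>Z\<close>, where \<open>n\<close> is the index. A commutator \<open>c\<close> is in the kernel of
  \<open>V\<close> and has a power \<open>c\<^sup>k\<close> in \<open>Z\<close>, so \<open>(c\<^sup>k)\<^sup>n = V (c\<^sup>k) = \<one>\<close> and \<open>c = \<one>\<close>.
\<close>

lemma (in group) torsion_free_central_finite_index_commute:
  assumes tf: "torsion_free_group G" and Z: "subgroup Z G"
    and central: "\<And>z g. z \<in> Z \<Longrightarrow> g \<in> carrier G \<Longrightarrow> z \<otimes> g = g \<otimes> z"
    and fin: "finite (rcosets Z)"
    and xy: "x \<in> carrier G" "y \<in> carrier G"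
  shows "x \<otimes> y = y \<otimes> x"
proof -
  have Zc: "Z \<subseteq> carrier G" using Z by (rule subgroup.subset)
  let ?ZG = "G\<lparr>carrier := Z\<rparr>"
  interpret ZG: group ?ZG by (rule subgroup_imp_group[OF Z])
  interpret ZG: comm_group ?ZG
    by (rule ZG.group_comm_groupI) (use central Zc in \<open>auto simp: subset_iff\<close>)
  define rep :: "'a set \<Rightarrow> 'a" where "rep c = (SOME g. g \<in> c)" for c
  have rep: "rep c \<in> carrier G" "c = Z #> rep c" if c: "c \<in> rcosets Z" for c
  proof -
    obtain a where a: "a \<in> carrier G" "c = Z #> a" using c by (auto simp: RCOSETS_def)
    then have "a \<in> c" using rcos_self[OF _ Z] by simp
    then have r: "rep c \<in> c" unfolding rep_def by (rule someI)
    then show "rep c \<in> carrier G" using a r_coset_subset_G[OF Zc a(1)] by auto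
    show "c = Z #> rep c" using repr_independence[OF _ a(1) Z] r a(2) by simp
  qed
  have shift: "c #> g \<in> rcosets Z" if "c \<in> rcosets Z" "g \<in> carrier G" for c g
    using that Zc by (auto simp: RCOSETS_def coset_mult_assoc)
  have shift_shift: "c #> g #> h = c #> (g \<otimes> h)"
    if "c \<in> rcosets Z" "g \<in> carrier G" "h \<in> carrier G" for c g h
    using that subgroup.rcosets_carrier[OF Z is_group that(1)] coset_mult_assoc by simp
  \<comment> \<open>The cocycle of the chosen coset representatives: \<open>rep c \<otimes> g = \<tau> c g \<otimes> rep (c #> g)\<close>.\<close>
  define \<tau> where "\<tau> c g = rep c \<otimes> g \<otimes> inv (rep (c #> g))" for c g
  have \<tau>_Z: "\<tau> c g \<in> Z" if c: "c \<in> rcosets Z" and g: "g \<in> carrier G" for c g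
  proof -
    have "rep c \<otimes> g \<in> Z #> (rep c \<otimes> g)" using rep[OF c] g rcos_self[OF _ Z] by simp
    also have "Z #> (rep c \<otimes> g) = c #> g"
      using rep[OF c] g coset_mult_assoc[OF Zc, of "rep c" g] by simp
    also have "\<dots> = Z #> rep (c #> g)" using rep shift c g by blast
    finally obtain z where z: "z \<in> Z" "rep c \<otimes> g = z \<otimes> rep (c #> g)"
      by (auto simp: r_coset_def)
    then have "\<tau> c g = z"
      using rep[OF shift[OF c g]] Zc by (auto simp: \<tau>_def m_assoc subset_iff)
    with z show ?thesis by simp
  qed
  have \<tau>_mult: "\<tau> c (g \<otimes> h) = \<tau> c g \<otimes> \<tau> (c #> g) h"
    if c: "c \<in> rcosets Z" and gh: "g \<in> carrier G" "h \<in> carrier G" for c g h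
    using rep[OF c] rep[OF shift[OF c gh(1)]] rep[OF shift[OF c m_closed[OF gh]]] gh
    by (simp add: \<tau>_def m_assoc shift_shift[OF c gh])
  define V where "V g = finprod ?ZG (\<lambda>c. \<tau> c g) (rcosets Z)" for g
  have V_mult: "V (g \<otimes> h) = V g \<otimes> V h" if gh: "g \<in> carrier G" "h \<in> carrier G" for g h
  proof -
    have inj: "inj_on (\<lambda>c. c #> g) (rcosets Z)"
    proof (rule inj_onI)
      fix c d assume cd: "c \<in> rcosets Z" "d \<in> rcosets Z" "c #> g = d #> g"
      have "c #> g #> inv g = c" "d #> g #> inv g = d"
        using cd(1,2) gh subgroup.rcosets_carrier[OF Z is_group]
        by (simp_all add: shift_shift)
      with cd(3) show "c = d" by metis
    qed
    have "(\<lambda>c. c #> g) ` (rcosets Z) \<subseteq> rcosets Z" using shift gh by auto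
    then have img: "(\<lambda>c. c #> g) ` (rcosets Z) = rcosets Z"
      using inj fin by (metis card_image card_subset_eq)
    have "V (g \<otimes> h) = finprod ?ZG (\<lambda>c. \<tau> c g \<otimes>\<^bsub>?ZG\<^esub> \<tau> (c #> g) h) (rcosets Z)"
      unfolding V_def by (rule ZG.finprod_cong') (use \<tau>_mult \<tau>_Z shift gh in \<open>auto intro: subgroup.m_closed[OF Z]\<close>)
    also have "\<dots> = V g \<otimes> finprod ?ZG (\<lambda>c. \<tau> (c #> g) h) (rcosets Z)"
      unfolding V_def by (subst ZG.finprod_multf) (use \<tau>_Z shift gh in auto)
    also have "finprod ?ZG (\<lambda>c. \<tau> (c #> g) h) (rcosets Z)
        = finprod ?ZG (\<lambda>c. \<tau> c h) ((\<lambda>c. c #> g) ` (rcosets Z))"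
      by (rule ZG.finprod_reindex[symmetric]) (use \<tau>_Z shift gh inj in auto)
    finally show ?thesis unfolding img V_def .
  qed
  have V_Z: "V g \<in> Z" if "g \<in> carrier G" for g
    using ZG.finprod_closed[of "\<lambda>c. \<tau> c g" "rcosets Z"] \<tau>_Z that by (auto simp: V_def)
  interpret V: group_hom G ?ZG V
    by (intro group_hom.intro is_group ZG.is_group group_hom_axioms.intro)
      (auto simp: hom_def V_mult V_Z)
  have V_central: "V z = z [^] card (rcosets Z)" if z: "z \<in> Z" for z
  proof -
    have "\<tau> c z = z" if c: "c \<in> rcosets Z" for c
    proof -
      have "c #> z = Z #> (rep c \<otimes> z)"
        using rep[OF c] z Zc coset_mult_assoc[OF Zc, of "rep c" z] by auto
      also have "\<dots> = Z #> z #> rep c"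
        using rep(1)[OF c] z Zc central[OF z] coset_mult_assoc[OF Zc, of z "rep c"] by auto
      also have "\<dots> = c" using rep(2)[OF c] coset_join2[OF _ Z z] z Zc by auto
      finally have "c #> z = c" .
      then have "\<tau> c z = z \<otimes> rep c \<otimes> inv (rep c)"
        using central[OF z rep(1)[OF c]] by (simp add: \<tau>_def)
      then show ?thesis using rep(1)[OF c] z Zc by (auto simp: m_assoc)
    qed
    then have "V z = finprod ?ZG (\<lambda>c. z) (rcosets Z)"
      unfolding V_def by (intro ZG.finprod_cong') (use z in auto)
    then show ?thesis using ZG.finprod_const[of z] z by (simp flip: nat_pow_consistent)
  qed
  define c where "c = x \<otimes> y \<otimes> inv (y \<otimes> x)"
  have c: "c \<in> carrier G" using xy by (simp add: c_def)
  have "V c = V x \<otimes>\<^bsub>?ZG\<^esub> V y \<otimes>\<^bsub>?ZG\<^esub> inv\<^bsub>?ZG\<^esub> (V y \<otimes>\<^bsub>?ZG\<^esub> V x)"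
    unfolding c_def using xy by (simp only: V.hom_mult V.hom_inv m_closed inv_closed)
  also have "\<dots> = V x \<otimes>\<^bsub>?ZG\<^esub> V y \<otimes>\<^bsub>?ZG\<^esub> inv\<^bsub>?ZG\<^esub> (V x \<otimes>\<^bsub>?ZG\<^esub> V y)"
    using ZG.m_comm[of "V x" "V y"] V_Z xy by simp
  also have "\<dots> = \<one>"
    using ZG.r_inv[of "V x \<otimes>\<^bsub>?ZG\<^esub> V y"] V_Z xy subgroup.m_closed[OF Z] by simp
  finally have Vc: "V c = \<one>" .
  \<comment> \<open>Two powers of \<open>c\<close> lie in the same coset, so some positive power lies in \<open>Z\<close>.\<close>
  have "\<not> inj (\<lambda>n::nat. Z #> c [^] n)"
  proof
    assume "inj (\<lambda>n::nat. Z #> c [^] n)"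
    moreover have "finite (range (\<lambda>n::nat. Z #> c [^] n))"
      by (rule finite_subset[OF _ fin]) (use c rcosetsI[OF Zc] in auto)
    ultimately show False using finite_imageD infinite_UNIV_nat by blast
  qed
  then obtain m n :: nat where mn: "m \<noteq> n" "Z #> c [^] m = Z #> c [^] n"
    unfolding inj_def by blast
  obtain i j :: nat where ij: "i < j" "Z #> c [^] i = Z #> c [^] j"
    using mn that[of m n] that[of n m] by (cases "m < n") simp_all
  define k where "k = j - i"
  have k: "k > 0" "j = k + i" using ij by (auto simp: k_def)
  have "c [^] j \<in> Z #> c [^] i" using ij(2) rcos_self[OF _ Z, of "c [^] j"] c by simp
  then obtain z where z: "z \<in> Z" "c [^] j = z \<otimes> c [^] i" unfolding r_coset_def by blast
  then have "c [^] k \<otimes> c [^] i = z \<otimes> c [^] i" using c by (simp add: k nat_pow_mult)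
  with z have kZ: "c [^] k \<in> Z" using c Zc by (auto simp: subset_iff)
  have "card (rcosets Z) > 0"
    using fin rcosetsI[OF Zc one_closed] by (auto simp: card_gt_0_iff)
  moreover have "V (c [^] k) = \<one>"
    using V.hom_nat_pow[OF c, of k] Vc ZG.nat_pow_one[of k] by simp
  then have "c [^] (k * card (rcosets Z)) = \<one>"
    using V_central[OF kZ] c by (simp add: nat_pow_pow)
  ultimately have "k * card (rcosets Z) > 0 \<and> c [^] (k * card (rcosets Z)) = \<one>"
    using k(1) by simp
  then have "c = \<one>" using tf c unfolding torsion_free_group_def by blast
  then show ?thesis
    using xy inv_solve_right'[of \<one> "x \<otimes> y" "y \<otimes> x"] by (simp add: c_def)
qed

context group
begin

definition conjugate :: "'a \<Rightarrow> 'a \<Rightarrow> 'a"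
  where "conjugate x g = inv g \<otimes> x \<otimes> g"

definition centralizer :: "'a set \<Rightarrow> 'a set"
  where "centralizer A = {g \<in> carrier G. \<forall>a\<in>A. conjugate a g = a}"

definition fc_center :: "'a set"
  where "fc_center = {x \<in> carrier G. finite (conjugate x ` carrier G)}"

lemma conjugate_closed [simp]: "x \<in> carrier G \<Longrightarrow> g \<in> carrier G \<Longrightarrow> conjugate x g \<in> carrier G"
  by (simp add: conjugate_def)

lemma conjugate_by_mult:
  "x \<in> carrier G \<Longrightarrow> g \<in> carrier G \<Longrightarrow> h \<in> carrier G
    \<Longrightarrow> conjugate x (g \<otimes> h) = conjugate (conjugate x g) h"
  by (simp add: conjugate_def inv_mult_group m_assoc)

lemma conjugate_mult:
  "x \<in> carrier G \<Longrightarrow> y \<in> carrier G \<Longrightarrow> g \<in> carrier G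
    \<Longrightarrow> conjugate (x \<otimes> y) g = conjugate x g \<otimes> conjugate y g"
  by (simp add: conjugate_def m_assoc)

lemma conjugate_inv:
  "x \<in> carrier G \<Longrightarrow> g \<in> carrier G \<Longrightarrow> conjugate (inv x) g = inv (conjugate x g)"
  by (simp add: conjugate_def inv_mult_group m_assoc)

lemma conjugate_one [simp]: "g \<in> carrier G \<Longrightarrow> conjugate \<one> g = \<one>"
  "x \<in> carrier G \<Longrightarrow> conjugate x \<one> = x"
  by (simp_all add: conjugate_def)

lemma conjugate_cancel [simp]:
  "x \<in> carrier G \<Longrightarrow> g \<in> carrier G \<Longrightarrow> conjugate (conjugate x g) (inv g) = x"
  "x \<in> carrier G \<Longrightarrow> g \<in> carrier G \<Longrightarrow> conjugate (conjugate x (inv g)) g = x"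
  by (simp_all flip: conjugate_by_mult)

lemma conjugate_eq_iff:
  "x \<in> carrier G \<Longrightarrow> y \<in> carrier G \<Longrightarrow> g \<in> carrier G \<Longrightarrow> conjugate x g = y \<longleftrightarrow> x \<otimes> g = g \<otimes> y"
  unfolding conjugate_def by (metis inv_mult_cancel mult_inv_cancel m_assoc inv_closed m_closed)

lemma centralizer_subgroup:
  assumes "A \<subseteq> carrier G"
  shows "subgroup (centralizer A) G"
proof (rule subgroupI)
  fix g assume g: "g \<in> centralizer A"
  have "conjugate a (inv g) = a" if "a \<in> A" for a
    using g that assms conjugate_cancel(1)[of a g] by (auto simp: centralizer_def)
  then show "inv g \<in> centralizer A" using g by (simp add: centralizer_def)
qed (use assms in \<open>auto simp: centralizer_def conjugate_by_mult subset_iff\<close>)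

lemma fc_center_subgroup: "subgroup fc_center G"
proof (rule subgroupI)
  show "fc_center \<noteq> {}"
    using one_closed by (auto simp: fc_center_def intro!: exI[of _ \<one>] finite_subset[of _ "{\<one>}"])
next
  fix x assume "x \<in> fc_center"
  moreover from this have "conjugate (inv x) ` carrier G = (\<lambda>y. inv y) ` conjugate x ` carrier G"
    by (auto simp: fc_center_def image_image conjugate_inv)
  ultimately show "inv x \<in> fc_center" by (simp add: fc_center_def)
next
  fix x y assume xy: "x \<in> fc_center" "y \<in> fc_center"
  then have "conjugate (x \<otimes> y) ` carrier G
      \<subseteq> (\<lambda>(u, v). u \<otimes> v) ` (conjugate x ` carrier G \<times> conjugate y ` carrier G)"
    by (auto simp: fc_center_def conjugate_mult)
  moreover have "finite \<dots>" using xy by (simp add: fc_center_def)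
  ultimately have "finite (conjugate (x \<otimes> y) ` carrier G)" by (rule finite_subset)
  then show "x \<otimes> y \<in> fc_center" using xy by (simp add: fc_center_def)
qed (auto simp: fc_center_def)

text \<open>
  The elements \<open>x\<close> and \<open>y\<close> lie in the double centralizer \<open>D\<close> of the pair. The elements of \<open>D\<close> that
  commute with \<open>x\<close> and \<open>y\<close> are central in \<open>D\<close>, and they have finite index there because their cosets
  correspond to the conjugates of the pair under \<open>D\<close>. So the transfer argument applies inside \<open>D\<close>.
\<close>

lemma torsion_free_fc_center_commute:
  assumes tf: "torsion_free_group G" and x: "x \<in> fc_center" and y: "y \<in> fc_center"
  shows "x \<otimes> y = y \<otimes> x"
proof -
  have xy: "x \<in> carrier G" "y \<in> carrier G" using x y by (auto simp: fc_center_def)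
  define Z' where "Z' = centralizer {x, y}"
  define D where "D = centralizer Z'"
  define Z where "Z = D \<inter> Z'"
  have Z': "subgroup Z' G" unfolding Z'_def using xy by (intro centralizer_subgroup) auto
  have D: "subgroup D G" unfolding D_def by (intro centralizer_subgroup subgroup.subset[OF Z'])
  have Z: "subgroup Z G" unfolding Z_def by (rule subgroups_Inter_pair[OF D Z'])
  have carr: "Z \<subseteq> carrier G" "D \<subseteq> carrier G" "Z' \<subseteq> carrier G"
    using Z D Z' by (auto dest: subgroup.mem_carrier)
  interpret DG: group "G\<lparr>carrier := D\<rparr>" by (rule subgroup_imp_group[OF D])
  have ZD: "subgroup Z (G\<lparr>carrier := D\<rparr>)"
    by (rule subgroup_incl[OF Z D]) (simp add: Z_def)
  have central: "z \<otimes> g = g \<otimes> z" if "z \<in> Z" "g \<in> D" for z g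
    using that carr by (auto simp: Z_def D_def centralizer_def conjugate_eq_iff subset_iff)
  have fin: "finite (rcosets\<^bsub>G\<lparr>carrier := D\<rparr>\<^esub> Z)"
  proof -
    define \<phi> where "\<phi> g = (conjugate x g, conjugate y g)" for g
    have same: "Z #> g = Z #> h" if gh: "g \<in> D" "h \<in> D" "\<phi> g = \<phi> h" for g h
    proof -
      have c: "g \<in> carrier G" "h \<in> carrier G" using gh carr by auto
      have "g \<otimes> inv h \<in> D" using D gh by (simp add: subgroup.m_closed subgroup.m_inv_closed)
      moreover have "g \<otimes> inv h \<in> Z'"
        using gh(3) c xy by (simp add: Z'_def centralizer_def \<phi>_def conjugate_by_mult)
      ultimately have "Z #> (g \<otimes> inv h) = Z"
        using coset_join2[OF _ Z] c by (simp add: Z_def)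
      then show ?thesis using coset_mult_inv1[OF _ c] carr by simp
    qed
    have "Z #> g = Z #> inv_into D \<phi> (\<phi> g)" if "g \<in> D" for g
      by (rule same) (use that in \<open>auto simp: inv_into_into f_inv_into_f\<close>)
    then have "(\<lambda>g. Z #> g) ` D \<subseteq> (\<lambda>p. Z #> inv_into D \<phi> p) ` \<phi> ` D" by blast
    moreover have "\<phi> ` D \<subseteq> conjugate x ` carrier G \<times> conjugate y ` carrier G"
      using carr by (auto simp: \<phi>_def)
    then have "finite (\<phi> ` D)"
      by (rule finite_subset) (use x y in \<open>simp add: fc_center_def\<close>)
    ultimately have "finite ((\<lambda>g. Z #> g) ` D)" using finite_subset by blast
    moreover have "rcosets\<^bsub>G\<lparr>carrier := D\<rparr>\<^esub> Z = (\<lambda>g. Z #> g) ` D"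
      by (auto simp: RCOSETS_def)
    ultimately show ?thesis by simp
  qed
  have "x \<in> D" "y \<in> D"
    using xy carr by (auto simp: D_def centralizer_def Z'_def conjugate_eq_iff)
  then have "x \<otimes>\<^bsub>G\<lparr>carrier := D\<rparr>\<^esub> y = y \<otimes>\<^bsub>G\<lparr>carrier := D\<rparr>\<^esub> x"
    by - (rule DG.torsion_free_central_finite_index_commute[OF torsion_free_subgroup[OF tf D] ZD _ fin],
        simp_all, erule (1) central)
  then show ?thesis by simp
qed

text \<open>
  B. H. Neumann's lemma that a group is not a finite union of cosets of subgroups of infinite index,
  for the cosets \<open>{g. conjugate p g = q}\<close> of centralizers. The induction removes one element \<open>p\<close>.
  Since \<open>p\<close> has infinitely many conjugates, some coset \<open>{g. conjugate p g = conjugate p z}\<close> is not among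
  the covering ones, hence is covered by the cosets belonging to \<open>P\<close> alone. Every non-empty coset for \<open>p\<close> is a
  right translate of this one, so finitely many cosets for \<open>P\<close> would cover the whole group.
\<close>

lemma conjugate_avoiding_finite:
  assumes "finite P" "P \<subseteq> carrier G - fc_center" "finite E" "E \<subseteq> P \<times> carrier G"
  shows "\<exists>g\<in>carrier G. \<forall>(p, q)\<in>E. conjugate p g \<noteq> q"
  using assms
proof (induction P arbitrary: E)
  case empty
  then show ?case using one_closed by auto
next
  case (insert p P)
  have p: "p \<in> carrier G" "infinite (conjugate p ` carrier G)"
    using insert.prems by (auto simp: fc_center_def)
  show ?case
  proof (rule ccontr)
    assume "\<not> ?case"
    then have cover: "\<exists>(r, q)\<in>E. conjugate r g = q" if "g \<in> carrier G" for g
      using that by blast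
    have "finite (snd ` E)" using insert.prems by simp
    then obtain z where z: "z \<in> carrier G" "conjugate p z \<notin> snd ` E"
      using p(2) by (meson finite_subset image_subsetI)
    define T where "T = {(r, q) \<in> E. r \<noteq> p}"
    \<comment> \<open>A translating element: conjugation by \<open>t q\<close> takes \<open>p\<close> to \<open>q\<close> whenever \<open>q\<close> is a conjugate of \<open>p\<close>.\<close>
    define t where "t q = (SOME y. y \<in> carrier G \<and> conjugate p y = q)" for q
    \<comment> \<open>Right translation by \<open>inv z \<otimes> t s\<close> moves the coset of \<open>z\<close> to the one for \<open>(p, s)\<close>. Where \<open>s\<close> is
        not a conjugate of \<open>p\<close> the value \<open>t s\<close> is arbitrary, hence the intersection.\<close>
    define E' where
      "E' = (T \<union> (\<lambda>((r, q), s). (r, conjugate q (inv z \<otimes> t s))) ` (T \<times> snd ` E)) \<inter> P \<times> carrier G"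
    have T: "finite T" "T \<subseteq> P \<times> carrier G"
      "\<And>g. g \<in> carrier G \<Longrightarrow> conjugate p g = conjugate p z \<Longrightarrow> \<exists>(r, q)\<in>T. conjugate r g = q"
    proof -
      show "finite T" using insert.prems by (auto simp: T_def intro: finite_subset)
      show "T \<subseteq> P \<times> carrier G" using insert.prems by (auto simp: T_def)
      fix g assume g: "g \<in> carrier G" "conjugate p g = conjugate p z"
      obtain r q where rq: "(r, q) \<in> E" "conjugate r g = q" using cover[OF g(1)] by blast
      have "r \<noteq> p" using rq g(2) z(2) by force
      with rq show "\<exists>(r, q)\<in>T. conjugate r g = q" by (auto simp: T_def)
    qed
    have "\<exists>g\<in>carrier G. \<forall>(r, q)\<in>E'. conjugate r g \<noteq> q"
    proof (rule insert.IH)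
      show "finite E'" using T insert.prems by (simp add: E'_def)
    qed (use insert.prems in \<open>auto simp: E'_def\<close>)
    then obtain g where g: "g \<in> carrier G" "\<And>r q. (r, q) \<in> E' \<Longrightarrow> conjugate r g \<noteq> q" by blast
    obtain r q where rq: "(r, q) \<in> E" "conjugate r g = q" using cover[OF g(1)] by blast
    have "r = p"
    proof (rule ccontr)
      assume "r \<noteq> p"
      then have "(r, q) \<in> E'" using rq insert.prems by (auto simp: E'_def T_def)
      with g(2) rq(2) show False by blast
    qed
    then have "t q \<in> carrier G \<and> conjugate p (t q) = q"
      unfolding t_def using rq g(1) by - (rule someI[of "\<lambda>y. y \<in> carrier G \<and> conjugate p y = q" g], simp)
    then have t: "t q \<in> carrier G" "conjugate p g = conjugate p (t q)" using rq \<open>r = p\<close> by auto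
    define h where "h = g \<otimes> inv (t q) \<otimes> z"
    have "h \<in> carrier G" using g t z by (simp add: h_def)
    moreover have "conjugate p h = conjugate p z"
      using g(1) t z(1) p(1) by (simp add: h_def conjugate_by_mult)
    ultimately obtain r' q' where rq': "(r', q') \<in> T" "conjugate r' h = q'" using T(3) by blast
    have c': "r' \<in> carrier G" "q' \<in> carrier G" "r' \<in> P"
      using rq' T(2) insert.prems by auto
    have "conjugate q' (inv z \<otimes> t q) = conjugate r' (h \<otimes> (inv z \<otimes> t q))"
      using rq'(2) c' \<open>h \<in> carrier G\<close> z t by (simp add: conjugate_by_mult)
    also have "h \<otimes> (inv z \<otimes> t q) = g" using g(1) t z by (simp add: h_def m_assoc)
    finally have eq: "conjugate q' (inv z \<otimes> t q) = conjugate r' g" .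
    have "(r', conjugate q' (inv z \<otimes> t q)) \<in> E'"
      unfolding E'_def using rq'(1) rq(1) c' z t by (force simp: image_iff)
    with g(2) eq show False by metis
  qed
qed

text \<open>
  The centralizer of a finite subset of the FC-centre has finite index, so if it were covered by
  finitely many cosets then so would be the whole group, by translating along representatives.
\<close>

lemma centralizer_conjugate_avoiding_finite:
  assumes F: "finite F" "F \<subseteq> fc_center"
    and P: "finite P" "P \<subseteq> carrier G - fc_center" and E: "finite E" "E \<subseteq> P \<times> carrier G"
  obtains g where "g \<in> centralizer F" "\<And>p q. (p, q) \<in> E \<Longrightarrow> conjugate p g \<noteq> q"
proof -
  have Fc: "F \<subseteq> carrier G" using F by (auto simp: fc_center_def)
  \<comment> \<open>Elements with the same image under \<open>\<phi>\<close> differ by an element of the centralizer of \<open>F\<close>.\<close>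
  define \<phi> where "\<phi> g = restrict (\<lambda>f. conjugate f g) F" for g
  define rep where "rep g = inv_into (carrier G) \<phi> (\<phi> g)" for g
  have rep: "rep g \<in> carrier G" "\<And>f. f \<in> F \<Longrightarrow> conjugate f (rep g) = conjugate f g"
    if "g \<in> carrier G" for g
  proof -
    show "rep g \<in> carrier G" using that by (auto simp: rep_def intro: inv_into_into)
    have "\<phi> (rep g) = \<phi> g" using that by (auto simp: rep_def f_inv_into_f)
    then show "conjugate f (rep g) = conjugate f g" if "f \<in> F" for f
      using that by (auto simp: \<phi>_def restrict_def fun_eq_iff split: if_splits)
  qed
  have "\<phi> ` carrier G \<subseteq> (\<Pi>\<^sub>E f\<in>F. conjugate f ` carrier G)" by (auto simp: \<phi>_def)
  moreover have "finite \<dots>" using F by (intro finite_PiE) (auto simp: fc_center_def)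
  ultimately have "finite (\<phi> ` carrier G)" by (rule finite_subset)
  moreover have "rep ` carrier G = inv_into (carrier G) \<phi> ` \<phi> ` carrier G"
    by (auto simp: rep_def)
  ultimately have fin: "finite (rep ` carrier G)" by simp
  define E' where "E' = (\<lambda>((p, q), y). (p, conjugate q y)) ` (E \<times> rep ` carrier G)"
  have "finite E'" unfolding E'_def using E fin by blast
  moreover have "E' \<subseteq> P \<times> carrier G" using E rep(1) by (auto simp: E'_def)
  ultimately have "\<exists>g\<in>carrier G. \<forall>(p, q)\<in>E'. conjugate p g \<noteq> q"
    by (rule conjugate_avoiding_finite[OF P])
  then obtain g where g: "g \<in> carrier G" "\<And>p q. (p, q) \<in> E' \<Longrightarrow> conjugate p g \<noteq> q"
    by blast
  define x where "x = g \<otimes> inv (rep g)"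
  have x: "x \<in> carrier G" using g rep by (simp add: x_def)
  show thesis
  proof (rule that)
    have "conjugate f x = f" if "f \<in> F" for f
    proof -
      have "f \<in> carrier G" using that Fc by auto
      then show ?thesis
        using rep[OF g(1)] g(1) that conjugate_cancel(1)[of f "rep g"]
        by (simp add: x_def conjugate_by_mult)
    qed
    then show "x \<in> centralizer F" using x by (simp add: centralizer_def)
    fix p q assume pq: "(p, q) \<in> E"
    then have c: "p \<in> carrier G" "q \<in> carrier G" using E P by auto
    show "conjugate p x \<noteq> q"
    proof
      assume "conjugate p x = q"
      then have "conjugate p g = conjugate q (rep g)"
        using c g(1) rep[OF g(1)] by (auto simp: x_def conjugate_by_mult)
      moreover have "(p, conjugate q (rep g)) \<in> E'"
        unfolding E'_def using pq g(1) by (force simp: image_iff)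
      ultimately show False using g(2) by blast
    qed
  qed
qed

text \<open>
  The FC-centre \<open>F\<close> is torsion-free abelian, so \<open>A \<inter> F\<close> and \<open>B \<inter> F\<close> have a unique product \<open>g \<otimes> h\<close>. Choose
  \<open>x\<close> to commute with \<open>A \<inter> F\<close>. Then \<open>g' x h' = g x h\<close> with \<open>g'\<close> in \<open>F\<close> gives \<open>g' h' = g h\<close>, so \<open>h'\<close> is in \<open>F\<close> as
  well and nothing new arises, while for \<open>g'\<close> outside \<open>F\<close> the equation determines the conjugate of \<open>g'\<close> by \<open>x\<close>,
  which can be avoided.
\<close>

lemma torsion_free_unique_factors_insert:
  assumes tf: "torsion_free_group G"
    and A: "A \<subseteq> carrier G" "finite A" "A \<noteq> {}" and B: "B \<subseteq> carrier G" "finite B" "B \<noteq> {}"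
  obtains x g h where "x \<in> carrier G" "unique_factors G ((\<lambda>a. a \<otimes> x) ` A) B g h"
proof -
  let ?F = "fc_center"
  have Fc: "?F \<subseteq> carrier G" by (auto simp: fc_center_def)
  \<comment> \<open>Translating both sets so that they contain \<open>\<one>\<close> makes their intersections with \<open>F\<close> non-empty.\<close>
  have normalized: "\<exists>x\<in>carrier G. \<exists>g h. unique_factors G ((\<lambda>a. a \<otimes> x) ` A) B g h"
    if A: "A \<subseteq> carrier G" "finite A" "\<one> \<in> A" and B: "B \<subseteq> carrier G" "finite B" "\<one> \<in> B" for A B
  proof -
    interpret FG: group "G\<lparr>carrier := ?F\<rparr>" by (rule subgroup_imp_group[OF fc_center_subgroup])
    interpret FG: comm_group "G\<lparr>carrier := ?F\<rparr>"
      by (rule FG.group_comm_groupI) (simp add: torsion_free_fc_center_commute[OF tf])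
    have one: "\<one> \<in> ?F" by (rule subgroup.one_closed[OF fc_center_subgroup])
    obtain g h where "unique_factors (G\<lparr>carrier := ?F\<rparr>) (A \<inter> ?F) (B \<inter> ?F) g h"
      by (rule FG.torsion_free_unique_factors[OF torsion_free_subgroup[OF tf fc_center_subgroup],
            of "A \<inter> ?F" "B \<inter> ?F"]) (use A B one in auto)
    then have g: "g \<in> A" "g \<in> ?F" and h: "h \<in> B" "h \<in> ?F"
      and uniq: "\<And>g' h'. g' \<in> A \<Longrightarrow> g' \<in> ?F \<Longrightarrow> h' \<in> B \<Longrightarrow> h' \<in> ?F
        \<Longrightarrow> g' \<otimes> h' = g \<otimes> h \<Longrightarrow> g' = g \<and> h' = h"
      by (auto simp: unique_factors_def)
    have gh: "g \<in> carrier G" "h \<in> carrier G" using g h Fc by auto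
    define E where "E = (\<lambda>(p, h'). (p, g \<otimes> h \<otimes> inv h')) ` ((A - ?F) \<times> B)"
    obtain x where x: "x \<in> centralizer (A \<inter> ?F)" "\<And>p q. (p, q) \<in> E \<Longrightarrow> conjugate p x \<noteq> q"
      by (rule centralizer_conjugate_avoiding_finite[of "A \<inter> ?F" "A - ?F" E])
        (use A B gh in \<open>auto simp: E_def subset_iff\<close>)
    have xc: "x \<in> carrier G" using x(1) by (simp add: centralizer_def)
    have comm: "p \<otimes> x = x \<otimes> p" if "p \<in> A" "p \<in> ?F" for p
      using x(1) that A(1) conjugate_eq_iff[of p p x] by (auto simp: centralizer_def)
    have "g' = g \<and> h' = h"
      if g': "g' \<in> A" and h': "h' \<in> B" and eq: "g' \<otimes> x \<otimes> h' = g \<otimes> x \<otimes> h" for g' h'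
    proof -
      have c: "g' \<in> carrier G" "h' \<in> carrier G" using g' h' A B by auto
      have eq': "g' \<otimes> x \<otimes> h' = x \<otimes> (g \<otimes> h)"
        unfolding eq using comm[OF g] gh xc by (simp add: m_assoc)
      show ?thesis
      proof (cases "g' \<in> ?F")
        case True
        then have "x \<otimes> (g' \<otimes> h') = x \<otimes> (g \<otimes> h)"
          using eq' comm[OF g' True] c xc by (simp add: m_assoc)
        then have gh': "g' \<otimes> h' = g \<otimes> h" using c gh xc by simp
        then have "h' = inv g' \<otimes> (g \<otimes> h)" using c inv_mult_cancel by metis
        then have "h' \<in> ?F"
          using True g h by (simp add: subgroup.m_closed subgroup.m_inv_closed fc_center_subgroup)
        then show ?thesis using uniq g' h' True gh' by blast
      next
        case False
        have "conjugate g' x = inv x \<otimes> (g' \<otimes> x \<otimes> h') \<otimes> inv h'"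
          using c xc by (simp add: conjugate_def m_assoc)
        then have "conjugate g' x = g \<otimes> h \<otimes> inv h'" unfolding eq' using gh xc by simp
        moreover have "(g', g \<otimes> h \<otimes> inv h') \<in> E" using False g' h' by (auto simp: E_def)
        ultimately show ?thesis using x(2) by blast
      qed
    qed
    then have "unique_factors G ((\<lambda>a. a \<otimes> x) ` A) B (g \<otimes> x) h"
      using g h by (auto simp: unique_factors_def)
    with xc show ?thesis by blast
  qed
  obtain a b where ab: "a \<in> A" "b \<in> B" using A B by auto
  then have c: "a \<in> carrier G" "b \<in> carrier G" using A B by auto
  define A' where "A' = (\<lambda>p. inv a \<otimes> p) ` A"
  define B' where "B' = (\<lambda>q. q \<otimes> inv b) ` B"
  have "\<one> \<in> A'" "\<one> \<in> B'"
    using ab c image_eqI[of \<one> "\<lambda>x. inv a \<otimes> x" a A] image_eqI[of \<one> "\<lambda>y. y \<otimes> inv b" b B]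
    by (simp_all add: A'_def B'_def)
  moreover have "A' \<subseteq> carrier G" "finite A'" "B' \<subseteq> carrier G" "finite B'"
    using A B c by (auto simp: A'_def B'_def)
  ultimately obtain x u v where x: "x \<in> carrier G"
    and uv: "unique_factors G ((\<lambda>a. a \<otimes> x) ` A') B' u v"
    using normalized[of A' B'] by blast
  have A'_x: "(\<lambda>a. a \<otimes> x) ` A' = (\<lambda>p. inv a \<otimes> p) ` (\<lambda>a. a \<otimes> x) ` A"
    unfolding A'_def image_image by (rule image_cong) (use A c x in \<open>auto simp: m_assoc\<close>)
  have "u \<in> (\<lambda>p. inv a \<otimes> p) ` (\<lambda>a. a \<otimes> x) ` A" "v \<in> (\<lambda>q. q \<otimes> inv b) ` B"
    using uv unfolding A'_x B'_def unique_factors_def by blast+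
  then obtain g h where gh: "g \<in> (\<lambda>a. a \<otimes> x) ` A" "u = inv a \<otimes> g" "h \<in> B" "v = h \<otimes> inv b"
    by blast
  have Ax: "(\<lambda>a. a \<otimes> x) ` A \<subseteq> carrier G" using A x by auto
  have "unique_factors G ((\<lambda>a. a \<otimes> x) ` A) B g h"
    using uv unique_factors_translate[OF Ax B(1), of "inv a" "inv b" g h] gh c Ax B(1)
    by (auto simp: A'_x B'_def)
  with x show thesis by (rule that)
qed

end

section \<open>Components of elements of a graded ring\<close>

context graded_ring
begin

definition component :: "'r \<Rightarrow> 'g \<Rightarrow> 'r"
  where "component r =
    inv_into (finsupp_families R S (carrier G)) (family_sum R (carrier G)) r"

definition support :: "'r \<Rightarrow> 'g set"
  where "support r = {g \<in> carrier G. component r g \<noteq> \<zero>\<^bsub>R\<^esub>}"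

lemma homogeneous_closed: "g \<in> carrier G \<Longrightarrow> x \<in> S g \<Longrightarrow> x \<in> carrier R"
  using additive_subgroup.a_subset[OF component_subgroup] by blast

lemma zero_homogeneous: "g \<in> carrier G \<Longrightarrow> \<zero>\<^bsub>R\<^esub> \<in> S g"
  by (rule additive_subgroup.zero_closed[OF component_subgroup])

lemma add_homogeneous: "g \<in> carrier G \<Longrightarrow> x \<in> S g \<Longrightarrow> y \<in> S g \<Longrightarrow> x \<oplus>\<^bsub>R\<^esub> y \<in> S g"
  by (rule additive_subgroup.a_closed[OF component_subgroup])

lemma component_family:
  assumes "r \<in> carrier R"
  shows "component r \<in> finsupp_families R S (carrier G)"
    and "family_sum R (carrier G) (component r) = r"
proof -
  have "r \<in> family_sum R (carrier G) ` finsupp_families R S (carrier G)"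
    using assms direct_sum by (simp add: bij_betw_def)
  then show "component r \<in> finsupp_families R S (carrier G)"
    and "family_sum R (carrier G) (component r) = r"
    unfolding component_def by (rule inv_into_into, rule f_inv_into_f)
qed

lemma component_homogeneous: "r \<in> carrier R \<Longrightarrow> g \<in> carrier G \<Longrightarrow> component r g \<in> S g"
  using component_family(1)[of r] by (auto simp: finsupp_families_def)

lemma component_closed: "r \<in> carrier R \<Longrightarrow> g \<in> carrier G \<Longrightarrow> component r g \<in> carrier R"
  using component_homogeneous homogeneous_closed by blast

lemma support_subset: "support r \<subseteq> carrier G"
  by (auto simp: support_def)

lemma finite_support: "r \<in> carrier R \<Longrightarrow> finite (support r)"
  using component_family(1)[of r] by (simp add: finsupp_families_def support_def)

lemma sum_components:
  assumes "r \<in> carrier R" "finite F" "support r \<subseteq> F" "F \<subseteq> carrier G"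
  shows "(\<Oplus>\<^bsub>R\<^esub>g\<in>F. component r g) = r"
proof -
  have "(\<Oplus>\<^bsub>R\<^esub>g\<in>support r. component r g) = (\<Oplus>\<^bsub>R\<^esub>g\<in>F. component r g)"
    by (rule R.add.finprod_mono_neutral_cong_left)
      (use assms in \<open>auto simp: support_def component_closed subset_iff\<close>)
  then show ?thesis
    using component_family(2)[OF assms(1)] by (simp add: family_sum_def support_def)
qed

lemma component_sum:
  assumes F: "finite F" "F \<subseteq> carrier G" and f: "\<And>g. g \<in> F \<Longrightarrow> f g \<in> S g"
    and g: "g \<in> carrier G"
  shows "component (\<Oplus>\<^bsub>R\<^esub>g\<in>F. f g) g = (if g \<in> F then f g else \<zero>\<^bsub>R\<^esub>)"
proof -
  define f' where "f' = restrict (\<lambda>g. if g \<in> F then f g else \<zero>\<^bsub>R\<^esub>) (carrier G)"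
  have sub: "{h \<in> carrier G. f' h \<noteq> \<zero>\<^bsub>R\<^esub>} \<subseteq> F" by (auto simp: f'_def)
  have f': "f' \<in> finsupp_families R S (carrier G)"
    using f F finite_subset[OF sub] by (auto simp: finsupp_families_def f'_def zero_homogeneous)
  have "family_sum R (carrier G) f' = (\<Oplus>\<^bsub>R\<^esub>g\<in>F. f g)"
    unfolding family_sum_def
    by (rule R.add.finprod_mono_neutral_cong_left)
      (use F f sub homogeneous_closed in \<open>auto simp: f'_def subset_iff\<close>)
  moreover have "component (family_sum R (carrier G) f') = f'"
    unfolding component_def
    by (rule inv_into_f_f[OF bij_betw_imp_inj_on[OF direct_sum] f'])
  ultimately have "component (\<Oplus>\<^bsub>R\<^esub>g\<in>F. f g) = f'" by simp
  then show ?thesis using g by (simp add: f'_def)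
qed

lemma component_of_homogeneous:
  assumes "x \<in> carrier G" "r \<in> S x" "g \<in> carrier G"
  shows "component r g = (if g = x then r else \<zero>\<^bsub>R\<^esub>)"
  using component_sum[of "{x}" "\<lambda>_. r" g] assms homogeneous_closed[OF assms(1,2)] by simp

lemma component_zero: "g \<in> carrier G \<Longrightarrow> component \<zero>\<^bsub>R\<^esub> g = \<zero>\<^bsub>R\<^esub>"
  using component_of_homogeneous[OF G.one_closed zero_homogeneous] by simp

lemma component_add:
  assumes "a \<in> carrier R" "b \<in> carrier R" "g \<in> carrier G"
  shows "component (a \<oplus>\<^bsub>R\<^esub> b) g = component a g \<oplus>\<^bsub>R\<^esub> component b g"
proof -
  define F where "F = support a \<union> support b"
  have F: "finite F" "F \<subseteq> carrier G" "support a \<subseteq> F" "support b \<subseteq> F"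
    using assms finite_support by (auto simp: F_def support_def)
  have "a \<oplus>\<^bsub>R\<^esub> b = (\<Oplus>\<^bsub>R\<^esub>g\<in>F. component a g) \<oplus>\<^bsub>R\<^esub> (\<Oplus>\<^bsub>R\<^esub>g\<in>F. component b g)"
    using sum_components F assms by simp
  also have "\<dots> = (\<Oplus>\<^bsub>R\<^esub>g\<in>F. component a g \<oplus>\<^bsub>R\<^esub> component b g)"
    by (rule R.finsum_addf[symmetric]) (use F assms component_closed in auto)
  finally have sum: "a \<oplus>\<^bsub>R\<^esub> b = (\<Oplus>\<^bsub>R\<^esub>g\<in>F. component a g \<oplus>\<^bsub>R\<^esub> component b g)" .
  have "component (a \<oplus>\<^bsub>R\<^esub> b) g
      = (if g \<in> F then component a g \<oplus>\<^bsub>R\<^esub> component b g else \<zero>\<^bsub>R\<^esub>)"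
    unfolding sum using F assms by (intro component_sum add_homogeneous component_homogeneous) auto
  moreover have "component a g = \<zero>\<^bsub>R\<^esub> \<and> component b g = \<zero>\<^bsub>R\<^esub>" if "g \<notin> F"
    using that assms by (simp add: F_def support_def)
  ultimately show ?thesis by auto
qed

lemma component_finsum:
  assumes "finite I" "f \<in> I \<rightarrow> carrier R" "g \<in> carrier G"
  shows "component (\<Oplus>\<^bsub>R\<^esub>i\<in>I. f i) g = (\<Oplus>\<^bsub>R\<^esub>i\<in>I. component (f i) g)"
  using assms
proof (induction I)
  case empty
  then show ?case by (simp add: component_zero)
next
  case (insert i I)
  have "component (\<Oplus>\<^bsub>R\<^esub>j\<in>insert i I. f j) g = component (f i \<oplus>\<^bsub>R\<^esub> (\<Oplus>\<^bsub>R\<^esub>j\<in>I. f j)) g"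
    using insert by (subst R.finsum_insert) auto
  also have "\<dots> = component (f i) g \<oplus>\<^bsub>R\<^esub> (\<Oplus>\<^bsub>R\<^esub>j\<in>I. component (f j) g)"
    using insert by (subst component_add) auto
  also have "\<dots> = (\<Oplus>\<^bsub>R\<^esub>j\<in>insert i I. component (f j) g)"
    using insert by (subst R.finsum_insert) (auto intro!: component_closed)
  finally show ?case .
qed

lemma support_empty_iff:
  assumes "r \<in> carrier R"
  shows "support r = {} \<longleftrightarrow> r = \<zero>\<^bsub>R\<^esub>"
  using sum_components[of r "{}"] assms by (auto simp: support_def component_zero)

lemma component_product:
  assumes a: "a \<in> carrier R" and b: "b \<in> carrier R"
    and A: "finite A" "support a \<subseteq> A" "A \<subseteq> carrier G"
    and B: "finite B" "support b \<subseteq> B" "B \<subseteq> carrier G"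
    and k: "k \<in> carrier G"
  shows "component (a \<otimes>\<^bsub>R\<^esub> b) k =
    (\<Oplus>\<^bsub>R\<^esub>g\<in>A. \<Oplus>\<^bsub>R\<^esub>h\<in>B. if g \<otimes>\<^bsub>G\<^esub> h = k then component a g \<otimes>\<^bsub>R\<^esub> component b h else \<zero>\<^bsub>R\<^esub>)"
proof -
  have ca: "component a g \<in> carrier R" if "g \<in> A" for g
    using that a A component_closed by auto
  have cb: "component b h \<in> carrier R" if "h \<in> B" for h
    using that b B component_closed by auto
  have row: "component a g \<otimes>\<^bsub>R\<^esub> b = (\<Oplus>\<^bsub>R\<^esub>h\<in>B. component a g \<otimes>\<^bsub>R\<^esub> component b h)" if "g \<in> A" for g
    using R.finsum_rdistr[OF B(1) ca[OF that], of "component b"] cb sum_components[OF b B] by auto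
  have "a \<otimes>\<^bsub>R\<^esub> b = (\<Oplus>\<^bsub>R\<^esub>g\<in>A. component a g \<otimes>\<^bsub>R\<^esub> b)"
    using R.finsum_ldistr[OF A(1) b, of "component a"] ca sum_components[OF a A] by auto
  also have "component \<dots> k = (\<Oplus>\<^bsub>R\<^esub>g\<in>A. component (component a g \<otimes>\<^bsub>R\<^esub> b) k)"
    by (rule component_finsum) (use A b ca k in auto)
  also have "\<dots> = (\<Oplus>\<^bsub>R\<^esub>g\<in>A. \<Oplus>\<^bsub>R\<^esub>h\<in>B.
      if g \<otimes>\<^bsub>G\<^esub> h = k then component a g \<otimes>\<^bsub>R\<^esub> component b h else \<zero>\<^bsub>R\<^esub>)"
  proof (rule R.finsum_cong')
    fix g assume g: "g \<in> A"
    have "component (component a g \<otimes>\<^bsub>R\<^esub> b) k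
        = (\<Oplus>\<^bsub>R\<^esub>h\<in>B. component (component a g \<otimes>\<^bsub>R\<^esub> component b h) k)"
      unfolding row[OF g] by (rule component_finsum) (use B ca[OF g] cb k in auto)
    also have "\<dots> = (\<Oplus>\<^bsub>R\<^esub>h\<in>B.
        if g \<otimes>\<^bsub>G\<^esub> h = k then component a g \<otimes>\<^bsub>R\<^esub> component b h else \<zero>\<^bsub>R\<^esub>)"
    proof (rule R.finsum_cong')
      fix h assume h: "h \<in> B"
      have c: "g \<in> carrier G" "h \<in> carrier G" using g h A B by auto
      then have "component a g \<otimes>\<^bsub>R\<^esub> component b h \<in> S (g \<otimes>\<^bsub>G\<^esub> h)"
        using a b by (intro component_mult component_homogeneous)
      then show "component (component a g \<otimes>\<^bsub>R\<^esub> component b h) k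
          = (if g \<otimes>\<^bsub>G\<^esub> h = k then component a g \<otimes>\<^bsub>R\<^esub> component b h else \<zero>\<^bsub>R\<^esub>)"
        using component_of_homogeneous[OF G.m_closed[OF c] _ k] by auto
    qed (use ca[OF g] cb in auto)
    finally show "component (component a g \<otimes>\<^bsub>R\<^esub> b) k = (\<Oplus>\<^bsub>R\<^esub>h\<in>B.
        if g \<otimes>\<^bsub>G\<^esub> h = k then component a g \<otimes>\<^bsub>R\<^esub> component b h else \<zero>\<^bsub>R\<^esub>)" .
  qed (use ca cb in \<open>auto intro!: R.finsum_closed\<close>)
  finally show ?thesis .
qed

lemma support_mult:
  assumes a: "a \<in> carrier R" and b: "b \<in> carrier R" and k: "k \<in> support (a \<otimes>\<^bsub>R\<^esub> b)"
  obtains g h where "g \<in> support a" "h \<in> support b" "k = g \<otimes>\<^bsub>G\<^esub> h"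
proof (rule ccontr)
  assume "\<not> thesis"
  with that have ne: "g \<otimes>\<^bsub>G\<^esub> h \<noteq> k" if "g \<in> support a" "h \<in> support b" for g h
    using that by blast
  have "component (a \<otimes>\<^bsub>R\<^esub> b) k = (\<Oplus>\<^bsub>R\<^esub>g\<in>support a. \<Oplus>\<^bsub>R\<^esub>h\<in>support b. \<zero>\<^bsub>R\<^esub>)"
    using k ne component_product[OF a b finite_support[OF a] _ support_subset finite_support[OF b] _ support_subset, of k]
    by (auto simp: support_def cong: R.finsum_cong)
  then show False using k by (simp add: support_def)
qed

text \<open>
  A degree with only one factorization over the two supports receives a single term. The factors \<open>g\<close> and \<open>h\<close>
  may lie outside the supports, in which case both sides vanish; this makes multiplication by a
  homogeneous element a special case.
\<close>

lemma component_product_unique: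
  assumes a: "a \<in> carrier R" and b: "b \<in> carrier R"
    and g: "g \<in> carrier G" and h: "h \<in> carrier G"
    and uniq: "\<And>g' h'. g' \<in> support a \<Longrightarrow> h' \<in> support b \<Longrightarrow> g' \<otimes>\<^bsub>G\<^esub> h' = g \<otimes>\<^bsub>G\<^esub> h
      \<Longrightarrow> g' = g \<and> h' = h"
  shows "component (a \<otimes>\<^bsub>R\<^esub> b) (g \<otimes>\<^bsub>G\<^esub> h) = component a g \<otimes>\<^bsub>R\<^esub> component b h"
proof -
  define A where "A = insert g (support a)"
  define B where "B = insert h (support b)"
  have A: "finite A" "support a \<subseteq> A" "A \<subseteq> carrier G"
    using g support_subset finite_support[OF a] by (auto simp: A_def)
  have B: "finite B" "support b \<subseteq> B" "B \<subseteq> carrier G"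
    using h support_subset finite_support[OF b] by (auto simp: B_def)
  have c: "component a g' \<in> carrier R" "component b h' \<in> carrier R"
    if "g' \<in> carrier G" "h' \<in> carrier G" for g' h'
    using that a b component_closed by auto
  let ?t = "\<lambda>g' h'. if g' \<otimes>\<^bsub>G\<^esub> h' = g \<otimes>\<^bsub>G\<^esub> h then component a g' \<otimes>\<^bsub>R\<^esub> component b h' else \<zero>\<^bsub>R\<^esub>"
  \<comment> \<open>All terms vanish except possibly the one at \<open>(g, h)\<close>, in the form that \<open>R.finsum_singleton\<close> expects.\<close>
  have t: "?t g' h' = (if h = h' then (if g = g' then component a g' \<otimes>\<^bsub>R\<^esub> component b h' else \<zero>\<^bsub>R\<^esub>) else \<zero>\<^bsub>R\<^esub>)"
    if "g' \<in> A" "h' \<in> B" for g' h'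
  proof -
    have c': "g' \<in> carrier G" "h' \<in> carrier G" using that A B by auto
    show ?thesis
    proof (cases "g' = g \<and> h' = h")
      case False
      have "?t g' h' = \<zero>\<^bsub>R\<^esub>"
      proof (cases "g' \<in> support a \<and> h' \<in> support b")
        case True
        with uniq False show ?thesis by auto
      next
        case False
        then have "component a g' = \<zero>\<^bsub>R\<^esub> \<or> component b h' = \<zero>\<^bsub>R\<^esub>"
          using c' by (auto simp: support_def)
        then show ?thesis using c[OF c'] by auto
      qed
      with False show ?thesis by auto
    qed auto
  qed
  have "component (a \<otimes>\<^bsub>R\<^esub> b) (g \<otimes>\<^bsub>G\<^esub> h) = (\<Oplus>\<^bsub>R\<^esub>g'\<in>A. \<Oplus>\<^bsub>R\<^esub>h'\<in>B. ?t g' h')"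
    by (rule component_product[OF a b A B]) (use g h in simp)
  also have "\<dots> = (\<Oplus>\<^bsub>R\<^esub>g'\<in>A. if g = g' then component a g' \<otimes>\<^bsub>R\<^esub> component b h else \<zero>\<^bsub>R\<^esub>)"
  proof (rule R.finsum_cong')
    fix g' assume g': "g' \<in> A"
    have "(\<Oplus>\<^bsub>R\<^esub>h'\<in>B. ?t g' h') = (\<Oplus>\<^bsub>R\<^esub>h'\<in>B. if h = h' then
        (if g = g' then component a g' \<otimes>\<^bsub>R\<^esub> component b h' else \<zero>\<^bsub>R\<^esub>) else \<zero>\<^bsub>R\<^esub>)"
      by (rule R.finsum_cong') (use t[OF g'] A B c g' in \<open>auto simp: subset_iff\<close>)
    also have "\<dots> = (if g = g' then component a g' \<otimes>\<^bsub>R\<^esub> component b h else \<zero>\<^bsub>R\<^esub>)"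
      by (rule R.finsum_singleton) (use A B c g' in \<open>auto simp: B_def subset_iff\<close>)
    finally show "(\<Oplus>\<^bsub>R\<^esub>h'\<in>B. ?t g' h')
        = (if g = g' then component a g' \<otimes>\<^bsub>R\<^esub> component b h else \<zero>\<^bsub>R\<^esub>)" .
  qed (use A c h in \<open>auto simp: subset_iff\<close>)
  also have "\<dots> = component a g \<otimes>\<^bsub>R\<^esub> component b h"
    by (rule R.finsum_singleton) (use A c h in \<open>auto simp: A_def subset_iff\<close>)
  finally show ?thesis .
qed

lemma support_of_homogeneous:
  assumes "x \<in> carrier G" "r \<in> S x"
  shows "support r \<subseteq> {x}"
  using component_of_homogeneous[OF assms] by (auto simp: support_def split: if_splits)

lemma component_product_homogeneous_right:
  assumes a: "a \<in> carrier R" and r: "r \<in> S x" and x: "x \<in> carrier G" and g: "g \<in> carrier G"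
  shows "component (a \<otimes>\<^bsub>R\<^esub> r) (g \<otimes>\<^bsub>G\<^esub> x) = component a g \<otimes>\<^bsub>R\<^esub> r"
proof -
  have "component (a \<otimes>\<^bsub>R\<^esub> r) (g \<otimes>\<^bsub>G\<^esub> x) = component a g \<otimes>\<^bsub>R\<^esub> component r x"
    using support_of_homogeneous[OF x r] support_subset g x
    by (intro component_product_unique a homogeneous_closed[OF x r] g x) (auto simp: subset_iff)
  then show ?thesis using component_of_homogeneous[OF x r x] by simp
qed

lemma component_product_homogeneous_left:
  assumes a: "a \<in> carrier R" and r: "r \<in> S x" and x: "x \<in> carrier G" and g: "g \<in> carrier G"
  shows "component (r \<otimes>\<^bsub>R\<^esub> a) (x \<otimes>\<^bsub>G\<^esub> g) = r \<otimes>\<^bsub>R\<^esub> component a g"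
proof -
  have "component (r \<otimes>\<^bsub>R\<^esub> a) (x \<otimes>\<^bsub>G\<^esub> g) = component r x \<otimes>\<^bsub>R\<^esub> component a g"
    using support_of_homogeneous[OF x r] support_subset g x
    by (intro component_product_unique a homogeneous_closed[OF x r] g x) (auto simp: subset_iff)
  then show ?thesis using component_of_homogeneous[OF x r x] by simp
qed

text \<open>
  Comparing degrees in \<open>r \<one> = r\<close> for homogeneous \<open>r\<close> shows that the component of \<open>\<one>\<close> at the identity is a
  right identity on homogeneous elements, hence on the components of \<open>\<one>\<close> and on \<open>\<one>\<close> itself.
\<close>

lemma one_homogeneous: "\<one>\<^bsub>R\<^esub> \<in> S \<one>\<^bsub>G\<^esub>"
proof -
  define u where "u = component \<one>\<^bsub>R\<^esub> \<one>\<^bsub>G\<^esub>"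
  have u: "u \<in> S \<one>\<^bsub>G\<^esub>" "u \<in> carrier R"
    by (simp_all add: u_def component_homogeneous component_closed)
  have unit: "r \<otimes>\<^bsub>R\<^esub> u = r" if r: "r \<in> S g" and g: "g \<in> carrier G" for r g
    using component_product_homogeneous_left[OF R.one_closed r g G.one_closed]
      component_of_homogeneous[OF g r g] homogeneous_closed[OF g r] g
    by (simp add: u_def)
  let ?F = "support \<one>\<^bsub>R\<^esub>"
  have F: "finite ?F" "?F \<subseteq> carrier G" "(\<Oplus>\<^bsub>R\<^esub>g\<in>?F. component \<one>\<^bsub>R\<^esub> g) = \<one>\<^bsub>R\<^esub>"
    using sum_components[OF R.one_closed finite_support] support_subset finite_support by auto
  have "\<one>\<^bsub>R\<^esub> \<otimes>\<^bsub>R\<^esub> u = (\<Oplus>\<^bsub>R\<^esub>g\<in>?F. component \<one>\<^bsub>R\<^esub> g \<otimes>\<^bsub>R\<^esub> u)"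
    using R.finsum_ldistr[OF F(1) u(2), of "component \<one>\<^bsub>R\<^esub>"] F component_closed by auto
  also have "\<dots> = (\<Oplus>\<^bsub>R\<^esub>g\<in>?F. component \<one>\<^bsub>R\<^esub> g)"
    by (rule R.finsum_cong')
      (use F(2) component_closed unit[OF component_homogeneous[OF R.one_closed]] in
        \<open>auto simp: subset_iff\<close>)
  finally have "u = \<one>\<^bsub>R\<^esub>" using F u by simp
  with u show ?thesis by simp
qed

lemma graded_part_iff:
  assumes H: "H \<subseteq> carrier G"
  shows "r \<in> graded_part R S H \<longleftrightarrow> r \<in> carrier R \<and> support r \<subseteq> H"
proof
  assume "r \<in> graded_part R S H"
  then obtain f where f: "f \<in> (\<Pi>\<^sub>E h\<in>H. S h)" "finite {h \<in> H. f h \<noteq> \<zero>\<^bsub>R\<^esub>}"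
    and r: "r = (\<Oplus>\<^bsub>R\<^esub>h\<in>{h \<in> H. f h \<noteq> \<zero>\<^bsub>R\<^esub>}. f h)"
    by (auto simp: graded_part_def finsupp_families_def family_sum_def)
  have fS: "f h \<in> S h" if "h \<in> H" for h using f that by auto
  have "r \<in> carrier R"
    unfolding r by (rule R.finsum_closed) (use fS H homogeneous_closed in \<open>auto simp: subset_iff\<close>)
  moreover have "component r g = \<zero>\<^bsub>R\<^esub>" if "g \<in> carrier G" "g \<notin> H" for g
    unfolding r using component_sum[OF f(2), of f g] that H fS by auto
  ultimately show "r \<in> carrier R \<and> support r \<subseteq> H" by (auto simp: support_def)
next
  assume r: "r \<in> carrier R \<and> support r \<subseteq> H"
  define f where "f = restrict (component r) H"
  have supp: "{h \<in> H. f h \<noteq> \<zero>\<^bsub>R\<^esub>} = support r"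
    using r H by (auto simp: f_def support_def)
  have "f \<in> finsupp_families R S H"
    unfolding finsupp_families_def mem_Collect_eq supp
    using r H finite_support component_homogeneous by (auto simp: f_def)
  moreover have "family_sum R H f = (\<Oplus>\<^bsub>R\<^esub>g\<in>support r. component r g)"
    unfolding family_sum_def supp
    by (rule R.finsum_cong') (use r component_closed in \<open>auto simp: f_def support_def\<close>)
  then have "family_sum R H f = r"
    using sum_components[OF _ finite_support _ support_subset] r by auto
  ultimately show "r \<in> graded_part R S H" unfolding graded_part_def by blast
qed

definition restriction :: "'g set \<Rightarrow> 'r \<Rightarrow> 'r"
  where "restriction H r = (\<Oplus>\<^bsub>R\<^esub>g\<in>support r \<inter> H. component r g)"

lemma restriction:
  assumes r: "r \<in> carrier R"
  shows "restriction H r \<in> carrier R"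
    and "g \<in> carrier G \<Longrightarrow> component (restriction H r) g = (if g \<in> H then component r g else \<zero>\<^bsub>R\<^esub>)"
    and "support (restriction H r) = support r \<inter> H"
proof -
  show c: "restriction H r \<in> carrier R"
    unfolding restriction_def
    by (rule R.finsum_closed) (use r component_closed in \<open>auto simp: support_def\<close>)
  have comp: "component (restriction H r) g = (if g \<in> H then component r g else \<zero>\<^bsub>R\<^esub>)"
    if g: "g \<in> carrier G" for g
  proof -
    have "component (restriction H r) g = (if g \<in> support r \<inter> H then component r g else \<zero>\<^bsub>R\<^esub>)"
      unfolding restriction_def
      by (rule component_sum)
        (use r g finite_support in \<open>auto simp: support_def intro!: component_homogeneous\<close>)
    then show ?thesis using g by (auto simp: support_def)
  qed
  then show "g \<in> carrier G \<Longrightarrow> component (restriction H r) g = (if g \<in> H then component r g else \<zero>\<^bsub>R\<^esub>)" .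
  show "support (restriction H r) = support r \<inter> H"
    using comp by (auto simp: support_def split: if_splits)
qed

end

section \<open>Non-degenerate gradings over a domain\<close>

lemma image_ne_singleton: "f ` A \<noteq> {z} \<Longrightarrow> A \<noteq> {} \<Longrightarrow> \<exists>s\<in>A. f s \<noteq> z"
  by (metis image_constant_conv image_cong)

locale nondegenerate_domain_grading = graded_ring G R S
  for G :: "('g, 'm) monoid_scheme" and R :: "('r, 'k) ring_scheme" and S :: "'g \<Rightarrow> 'r set" +
  assumes nondegenerate: "nondegenerate_grading G R S"
    and identity_component_domain: "nc_domain (R\<lparr>carrier := S \<one>\<^bsub>G\<^esub>\<rparr>)"
begin

lemma identity_component_no_zero_divisors:
  "x \<in> S \<one>\<^bsub>G\<^esub> \<Longrightarrow> y \<in> S \<one>\<^bsub>G\<^esub> \<Longrightarrow> x \<otimes>\<^bsub>R\<^esub> y = \<zero>\<^bsub>R\<^esub> \<Longrightarrow> x = \<zero>\<^bsub>R\<^esub> \<or> y = \<zero>\<^bsub>R\<^esub>"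
  using nc_domain.no_zero_divisors[OF identity_component_domain, of x y] by auto

lemma nontrivial: "\<one>\<^bsub>R\<^esub> \<noteq> \<zero>\<^bsub>R\<^esub>"
proof
  assume eq: "\<one>\<^bsub>R\<^esub> = \<zero>\<^bsub>R\<^esub>"
  have "x = \<zero>\<^bsub>R\<^esub>" if "x \<in> S \<one>\<^bsub>G\<^esub>" for x
    using R.l_one[of x] homogeneous_closed[OF _ that] by (simp add: eq)
  then have "S \<one>\<^bsub>G\<^esub> = {\<zero>\<^bsub>R\<^esub>}" using zero_homogeneous by auto
  then show False using nc_domain.nonzero[OF identity_component_domain] by simp
qed

lemma support_one: "support \<one>\<^bsub>R\<^esub> = {\<one>\<^bsub>G\<^esub>}"
  using support_of_homogeneous[OF G.one_closed one_homogeneous]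
    support_empty_iff[OF R.one_closed] nontrivial by blast

lemma nonzero_left_multiple:
  assumes "g \<in> carrier G" "r \<in> S g" "r \<noteq> \<zero>\<^bsub>R\<^esub>"
  obtains s where "s \<in> S (inv\<^bsub>G\<^esub> g)" "s \<otimes>\<^bsub>R\<^esub> r \<noteq> \<zero>\<^bsub>R\<^esub>"
proof -
  have "(\<lambda>s. s \<otimes>\<^bsub>R\<^esub> r) ` S (inv\<^bsub>G\<^esub> g) \<noteq> {\<zero>\<^bsub>R\<^esub>}"
    using nondegenerate assms unfolding nondegenerate_grading_def by blast
  moreover have "S (inv\<^bsub>G\<^esub> g) \<noteq> {}" using assms zero_homogeneous[of "inv\<^bsub>G\<^esub> g"] by auto
  ultimately show thesis using that image_ne_singleton by metis
qed

lemma nonzero_right_multiple: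
  assumes "g \<in> carrier G" "r \<in> S g" "r \<noteq> \<zero>\<^bsub>R\<^esub>"
  obtains s where "s \<in> S (inv\<^bsub>G\<^esub> g)" "r \<otimes>\<^bsub>R\<^esub> s \<noteq> \<zero>\<^bsub>R\<^esub>"
proof -
  have "(\<lambda>s. r \<otimes>\<^bsub>R\<^esub> s) ` S (inv\<^bsub>G\<^esub> g) \<noteq> {\<zero>\<^bsub>R\<^esub>}"
    using nondegenerate assms unfolding nondegenerate_grading_def by blast
  moreover have "S (inv\<^bsub>G\<^esub> g) \<noteq> {}" using assms zero_homogeneous[of "inv\<^bsub>G\<^esub> g"] by auto
  ultimately show thesis using that image_ne_singleton by metis
qed

text \<open>
  Non-degeneracy moves both factors into the component of the identity, which is a domain.
\<close>

lemma homogeneous_mult_nonzero: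
  assumes g: "g \<in> carrier G" and h: "h \<in> carrier G"
    and a: "a \<in> S g" "a \<noteq> \<zero>\<^bsub>R\<^esub>" and b: "b \<in> S h" "b \<noteq> \<zero>\<^bsub>R\<^esub>"
  shows "a \<otimes>\<^bsub>R\<^esub> b \<noteq> \<zero>\<^bsub>R\<^esub>"
proof
  assume ab: "a \<otimes>\<^bsub>R\<^esub> b = \<zero>\<^bsub>R\<^esub>"
  obtain s where s: "s \<in> S (inv\<^bsub>G\<^esub> g)" "s \<otimes>\<^bsub>R\<^esub> a \<noteq> \<zero>\<^bsub>R\<^esub>"
    by (rule nonzero_left_multiple[OF g a])
  obtain t where t: "t \<in> S (inv\<^bsub>G\<^esub> h)" "b \<otimes>\<^bsub>R\<^esub> t \<noteq> \<zero>\<^bsub>R\<^esub>"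
    by (rule nonzero_right_multiple[OF h b])
  have c: "a \<in> carrier R" "b \<in> carrier R" "s \<in> carrier R" "t \<in> carrier R"
    using homogeneous_closed[OF g a(1)] homogeneous_closed[OF h b(1)]
      homogeneous_closed[OF G.inv_closed[OF g] s(1)] homogeneous_closed[OF G.inv_closed[OF h] t(1)] .
  have "s \<otimes>\<^bsub>R\<^esub> a \<in> S \<one>\<^bsub>G\<^esub>" "b \<otimes>\<^bsub>R\<^esub> t \<in> S \<one>\<^bsub>G\<^esub>"
    using component_mult[OF _ g s(1) a(1)] component_mult[OF h _ b(1) t(1)] g h by simp_all
  moreover have "(s \<otimes>\<^bsub>R\<^esub> a) \<otimes>\<^bsub>R\<^esub> (b \<otimes>\<^bsub>R\<^esub> t) = s \<otimes>\<^bsub>R\<^esub> (a \<otimes>\<^bsub>R\<^esub> b) \<otimes>\<^bsub>R\<^esub> t"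
    using c by (simp add: R.m_assoc)
  then have "(s \<otimes>\<^bsub>R\<^esub> a) \<otimes>\<^bsub>R\<^esub> (b \<otimes>\<^bsub>R\<^esub> t) = \<zero>\<^bsub>R\<^esub>" using ab c by simp
  ultimately show False using identity_component_no_zero_divisors s(2) t(2) by blast
qed

lemma support_mult_homogeneous:
  assumes a: "a \<in> carrier R" and x: "x \<in> carrier G" and r: "r \<in> S x" "r \<noteq> \<zero>\<^bsub>R\<^esub>"
  shows "support (a \<otimes>\<^bsub>R\<^esub> r) = (\<lambda>g. g \<otimes>\<^bsub>G\<^esub> x) ` support a"
proof
  have rc: "r \<in> carrier R" by (rule homogeneous_closed[OF x r(1)])
  show "support (a \<otimes>\<^bsub>R\<^esub> r) \<subseteq> (\<lambda>g. g \<otimes>\<^bsub>G\<^esub> x) ` support a"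
  proof
    fix k assume "k \<in> support (a \<otimes>\<^bsub>R\<^esub> r)"
    then obtain g h where "g \<in> support a" "h \<in> support r" "k = g \<otimes>\<^bsub>G\<^esub> h"
      by (rule support_mult[OF a rc])
    then show "k \<in> (\<lambda>g. g \<otimes>\<^bsub>G\<^esub> x) ` support a" using support_of_homogeneous[OF x r(1)] by auto
  qed
  show "(\<lambda>g. g \<otimes>\<^bsub>G\<^esub> x) ` support a \<subseteq> support (a \<otimes>\<^bsub>R\<^esub> r)"
  proof
    fix k assume "k \<in> (\<lambda>g. g \<otimes>\<^bsub>G\<^esub> x) ` support a"
    then obtain g where g: "g \<in> carrier G" "component a g \<noteq> \<zero>\<^bsub>R\<^esub>" "k = g \<otimes>\<^bsub>G\<^esub> x"
      by (auto simp: support_def)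
    then have "component a g \<otimes>\<^bsub>R\<^esub> r \<noteq> \<zero>\<^bsub>R\<^esub>"
      using homogeneous_mult_nonzero[OF g(1) x component_homogeneous[OF a g(1)] g(2) r] by simp
    then show "k \<in> support (a \<otimes>\<^bsub>R\<^esub> r)"
      using component_product_homogeneous_right[OF a r(1) x g(1)] g x by (simp add: support_def)
  qed
qed

text \<open>
  Homogeneous multipliers exist only in degrees with a non-zero component. This lemma makes these degrees
  a group, to which the combinatorics of torsion-free groups can be applied.
\<close>

lemma nonzero_components_subgroup:
  assumes N: "subgroup N G"
  shows "subgroup {x \<in> N. S x \<noteq> {\<zero>\<^bsub>R\<^esub>}} G"
proof -
  have Nc: "N \<subseteq> carrier G" by (rule subgroup.subset[OF N])
  have nz: "\<exists>r\<in>S x. r \<noteq> \<zero>\<^bsub>R\<^esub>" if "x \<in> N" "S x \<noteq> {\<zero>\<^bsub>R\<^esub>}" for x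
    using that zero_homogeneous Nc by blast
  show ?thesis
  proof (rule G.subgroupI)
    show "{x \<in> N. S x \<noteq> {\<zero>\<^bsub>R\<^esub>}} \<subseteq> carrier G" using Nc by auto
    have "\<one>\<^bsub>G\<^esub> \<in> {x \<in> N. S x \<noteq> {\<zero>\<^bsub>R\<^esub>}}"
      using subgroup.one_closed[OF N] one_homogeneous nontrivial by auto
    then show "{x \<in> N. S x \<noteq> {\<zero>\<^bsub>R\<^esub>}} \<noteq> {}" by blast
  next
    fix x assume x: "x \<in> {x \<in> N. S x \<noteq> {\<zero>\<^bsub>R\<^esub>}}"
    then obtain r where r: "r \<in> S x" "r \<noteq> \<zero>\<^bsub>R\<^esub>" using nz by blast
    have xc: "x \<in> carrier G" using x Nc by auto
    obtain s where s: "s \<in> S (inv\<^bsub>G\<^esub> x)" "s \<otimes>\<^bsub>R\<^esub> r \<noteq> \<zero>\<^bsub>R\<^esub>"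
      by (rule nonzero_left_multiple[OF xc r])
    have "s \<noteq> \<zero>\<^bsub>R\<^esub>" using s(2) homogeneous_closed[OF xc r(1)] by auto
    then show "inv\<^bsub>G\<^esub> x \<in> {x \<in> N. S x \<noteq> {\<zero>\<^bsub>R\<^esub>}}"
      using s(1) x subgroup.m_inv_closed[OF N] by auto
  next
    fix x y assume x: "x \<in> {x \<in> N. S x \<noteq> {\<zero>\<^bsub>R\<^esub>}}" and y: "y \<in> {x \<in> N. S x \<noteq> {\<zero>\<^bsub>R\<^esub>}}"
    obtain r s where rs: "r \<in> S x" "r \<noteq> \<zero>\<^bsub>R\<^esub>" "s \<in> S y" "s \<noteq> \<zero>\<^bsub>R\<^esub>" using x y nz by blast
    have c: "x \<in> carrier G" "y \<in> carrier G" using x y Nc by auto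
    have "r \<otimes>\<^bsub>R\<^esub> s \<in> S (x \<otimes>\<^bsub>G\<^esub> y)" "r \<otimes>\<^bsub>R\<^esub> s \<noteq> \<zero>\<^bsub>R\<^esub>"
      using component_mult[OF c rs(1,3)] homogeneous_mult_nonzero[OF c rs] by auto
    then show "x \<otimes>\<^bsub>G\<^esub> y \<in> {x \<in> N. S x \<noteq> {\<zero>\<^bsub>R\<^esub>}}"
      using x y subgroup.m_closed[OF N] by auto
  qed
qed

text \<open>
  For \<open>x\<close> as in \<open>torsion_free_unique_factors_insert\<close> and a non-zero \<open>r\<close> of degree \<open>x\<close>, the component of
  \<open>a r b\<close> in the uniquely factored degree is a product of non-zero homogeneous elements.
\<close>

lemma torsion_free_part_prime:
  assumes N: "subgroup N G" and tf: "torsion_free_group (G\<lparr>carrier := N\<rparr>)"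
    and a: "a \<in> graded_part R S N" and b: "b \<in> graded_part R S N"
    and kill: "\<And>x r. x \<in> N \<Longrightarrow> r \<in> S x \<Longrightarrow> a \<otimes>\<^bsub>R\<^esub> r \<otimes>\<^bsub>R\<^esub> b = \<zero>\<^bsub>R\<^esub>"
  shows "a = \<zero>\<^bsub>R\<^esub> \<or> b = \<zero>\<^bsub>R\<^esub>"
proof (rule ccontr)
  assume nz: "\<not> ?thesis"
  have Nc: "N \<subseteq> carrier G" by (rule subgroup.subset[OF N])
  have ab: "a \<in> carrier R" "b \<in> carrier R" "support a \<subseteq> N" "support b \<subseteq> N"
    using a b graded_part_iff[OF Nc] by auto
  define H where "H = {x \<in> N. S x \<noteq> {\<zero>\<^bsub>R\<^esub>}}"
  have H: "subgroup H G" unfolding H_def by (rule nonzero_components_subgroup[OF N])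
  interpret NG: group "G\<lparr>carrier := N\<rparr>" by (rule G.subgroup_imp_group[OF N])
  interpret HG: group "G\<lparr>carrier := H\<rparr>" by (rule G.subgroup_imp_group[OF H])
  have "subgroup H (G\<lparr>carrier := N\<rparr>)"
    by (rule G.subgroup_incl[OF H N]) (auto simp: H_def)
  then have tfH: "torsion_free_group (G\<lparr>carrier := H\<rparr>)"
    using NG.torsion_free_subgroup[OF tf] by simp
  have H_supp: "support c \<subseteq> H" if "c \<in> carrier R" "support c \<subseteq> N" for c
    using that component_homogeneous[OF that(1)] by (auto simp: H_def support_def)
  obtain x g h where x: "x \<in> H"
    and "unique_factors (G\<lparr>carrier := H\<rparr>) ((\<lambda>g. g \<otimes>\<^bsub>G\<^esub> x) ` support a) (support b) g h"
    by (rule HG.torsion_free_unique_factors_insert[OF tfH, of "support a" "support b"])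
      (use ab nz H_supp finite_support support_empty_iff in auto)
  then have g: "g \<in> (\<lambda>g. g \<otimes>\<^bsub>G\<^esub> x) ` support a" and h: "h \<in> support b"
    and uniq: "\<And>g' h'. g' \<in> (\<lambda>g. g \<otimes>\<^bsub>G\<^esub> x) ` support a \<Longrightarrow> h' \<in> support b
      \<Longrightarrow> g' \<otimes>\<^bsub>G\<^esub> h' = g \<otimes>\<^bsub>G\<^esub> h \<Longrightarrow> g' = g \<and> h' = h"
    by (auto simp: unique_factors_def)
  have xN: "x \<in> N" "x \<in> carrier G" using x Nc by (auto simp: H_def)
  obtain r where r: "r \<in> S x" "r \<noteq> \<zero>\<^bsub>R\<^esub>"
    using x zero_homogeneous[OF xN(2)] by (auto simp: H_def)
  have rc: "r \<in> carrier R" by (rule homogeneous_closed[OF xN(2) r(1)])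
  have supp: "support (a \<otimes>\<^bsub>R\<^esub> r) = (\<lambda>g. g \<otimes>\<^bsub>G\<^esub> x) ` support a"
    by (rule support_mult_homogeneous[OF ab(1) xN(2) r])
  have gh: "g \<in> carrier G" "component (a \<otimes>\<^bsub>R\<^esub> r) g \<noteq> \<zero>\<^bsub>R\<^esub>" "h \<in> carrier G" "component b h \<noteq> \<zero>\<^bsub>R\<^esub>"
    using g h unfolding supp[symmetric] by (auto simp: support_def)
  have "component (a \<otimes>\<^bsub>R\<^esub> r \<otimes>\<^bsub>R\<^esub> b) (g \<otimes>\<^bsub>G\<^esub> h) = component (a \<otimes>\<^bsub>R\<^esub> r) g \<otimes>\<^bsub>R\<^esub> component b h"
    by (rule component_product_unique) (use ab rc gh uniq supp in auto)
  moreover have "\<dots> \<noteq> \<zero>\<^bsub>R\<^esub>"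
    by (rule homogeneous_mult_nonzero[OF gh(1,3) _ gh(2) _ gh(4)])
      (use ab rc gh component_homogeneous in auto)
  ultimately show False using kill[OF xN(1) r(1)] gh component_zero by simp
qed

lemma graded_part_mult:
  assumes N: "subgroup N G" and a: "a \<in> graded_part R S N" and b: "b \<in> graded_part R S N"
  shows "a \<otimes>\<^bsub>R\<^esub> b \<in> graded_part R S N"
proof -
  note iff = graded_part_iff[OF subgroup.subset[OF N]]
  have ab: "a \<in> carrier R" "b \<in> carrier R" using a b iff by auto
  have "k \<in> N" if k: "k \<in> support (a \<otimes>\<^bsub>R\<^esub> b)" for k
  proof -
    obtain g h where "g \<in> support a" "h \<in> support b" "k = g \<otimes>\<^bsub>G\<^esub> h"
      by (rule support_mult[OF ab k])
    then show ?thesis using a b iff subgroup.m_closed[OF N, of g h] by auto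
  qed
  then show ?thesis using ab iff by auto
qed

text \<open>
  If \<open>x\<^sup>2 = 0\<close>, then \<open>u = 1 + x\<close> is a unit with inverse \<open>1 - x\<close>, so it is homogeneous of some degree \<open>g\<close>. If
  \<open>g\<close> is the identity, then \<open>x\<close> lies in the identity component, which is a domain. Otherwise \<open>g\<^sup>2 \<noteq> \<one>\<close> too, and
  \<open>u\<^sup>2 + 1 = 2 u\<close> compares to \<open>1 = 0\<close> in the degree of the identity.
\<close>

lemma torsion_free_part_reduced:
  assumes N: "subgroup N G" and tf: "torsion_free_group (G\<lparr>carrier := N\<rparr>)"
    and units: "\<And>u. u \<in> Units R \<Longrightarrow> u \<in> graded_part R S N \<Longrightarrow> homogeneous G R S u"
    and x: "x \<in> graded_part R S N" and sq: "x \<otimes>\<^bsub>R\<^esub> x = \<zero>\<^bsub>R\<^esub>"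
  shows "x = \<zero>\<^bsub>R\<^esub>"
proof -
  note iff = graded_part_iff[OF subgroup.subset[OF N]]
  have xc: "x \<in> carrier R" "support x \<subseteq> N" using x iff by auto
  define u where "u = \<one>\<^bsub>R\<^esub> \<oplus>\<^bsub>R\<^esub> x"
  have uc: "u \<in> carrier R" using xc by (simp add: u_def)
  define v where "v = \<one>\<^bsub>R\<^esub> \<oplus>\<^bsub>R\<^esub> (\<ominus>\<^bsub>R\<^esub> x)"
  have vc: "v \<in> carrier R" using xc by (simp add: v_def)
  have "u \<otimes>\<^bsub>R\<^esub> v = \<one>\<^bsub>R\<^esub>" "v \<otimes>\<^bsub>R\<^esub> u = \<one>\<^bsub>R\<^esub>"
    using xc sq by (simp_all add: u_def v_def R.l_distr R.r_distr R.r_minus R.l_minus R.a_assoc R.l_neg R.r_neg)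
  then have unit: "u \<in> Units R" using uc vc by (auto simp: Units_def)
  have "support u \<subseteq> N"
  proof
    fix k assume k: "k \<in> support u"
    then have "component \<one>\<^bsub>R\<^esub> k \<noteq> \<zero>\<^bsub>R\<^esub> \<or> component x k \<noteq> \<zero>\<^bsub>R\<^esub>" "k \<in> carrier G"
      using component_add[OF R.one_closed xc(1), of k] by (auto simp: support_def u_def)
    then have "k \<in> support \<one>\<^bsub>R\<^esub> \<or> k \<in> support x" by (simp add: support_def)
    then show "k \<in> N" using support_one xc subgroup.one_closed[OF N] by auto
  qed
  then have uN: "u \<in> graded_part R S N" using uc iff by simp
  then obtain g where g: "g \<in> carrier G" "u \<in> S g" and u0: "u \<noteq> \<zero>\<^bsub>R\<^esub>"
    using units[OF unit] by (auto simp: homogeneous_def)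
  have gN: "g \<in> N"
    using support_of_homogeneous[OF g] support_empty_iff[OF uc] u0 \<open>support u \<subseteq> N\<close> by auto
  show ?thesis
  proof (cases "g = \<one>\<^bsub>G\<^esub>")
    case True
    have "x = u \<oplus>\<^bsub>R\<^esub> (\<ominus>\<^bsub>R\<^esub> \<one>\<^bsub>R\<^esub>)" using xc by (simp add: u_def R.a_ac R.r_neg)
    also have "\<dots> \<in> S \<one>\<^bsub>G\<^esub>"
      using g True one_homogeneous component_subgroup[OF G.one_closed]
      by (auto intro!: add_homogeneous additive_subgroup.a_inv_closed)
    finally show ?thesis using identity_component_no_zero_divisors[OF _ _ sq] by auto
  next
    case False
    have "g \<otimes>\<^bsub>G\<^esub> g \<noteq> \<one>\<^bsub>G\<^esub>"
    proof
      assume "g \<otimes>\<^bsub>G\<^esub> g = \<one>\<^bsub>G\<^esub>"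
      then have "g [^]\<^bsub>G\<lparr>carrier := N\<rparr>\<^esub> (2::nat) = \<one>\<^bsub>G\<^esub>"
        using g by (simp add: numeral_2_eq_2 flip: G.nat_pow_consistent)
      then show False
        using gN False
          tf[unfolded torsion_free_group_def, THEN conjunct2, rule_format, of g 2] by simp
    qed
    moreover have "u \<otimes>\<^bsub>R\<^esub> u \<in> S (g \<otimes>\<^bsub>G\<^esub> g)" by (rule component_mult[OF g(1) g(1) g(2) g(2)])
    ultimately have uu: "component (u \<otimes>\<^bsub>R\<^esub> u) \<one>\<^bsub>G\<^esub> = \<zero>\<^bsub>R\<^esub>"
      using component_of_homogeneous[of "g \<otimes>\<^bsub>G\<^esub> g" "u \<otimes>\<^bsub>R\<^esub> u" "\<one>\<^bsub>G\<^esub>"] g by auto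
    have u1: "component u \<one>\<^bsub>G\<^esub> = \<zero>\<^bsub>R\<^esub>"
      using component_of_homogeneous[OF g G.one_closed] False by auto
    have one1: "component \<one>\<^bsub>R\<^esub> \<one>\<^bsub>G\<^esub> = \<one>\<^bsub>R\<^esub>"
      using component_of_homogeneous[OF G.one_closed one_homogeneous G.one_closed] by simp
    have "u \<otimes>\<^bsub>R\<^esub> u \<oplus>\<^bsub>R\<^esub> \<one>\<^bsub>R\<^esub> = u \<oplus>\<^bsub>R\<^esub> u"
      using xc sq by (simp add: u_def R.l_distr R.r_distr R.a_ac)
    then have "component (u \<otimes>\<^bsub>R\<^esub> u \<oplus>\<^bsub>R\<^esub> \<one>\<^bsub>R\<^esub>) \<one>\<^bsub>G\<^esub> = component (u \<oplus>\<^bsub>R\<^esub> u) \<one>\<^bsub>G\<^esub>" by simp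
    then have "\<one>\<^bsub>R\<^esub> = \<zero>\<^bsub>R\<^esub>" using uc by (simp add: component_add uu u1 one1)
    with nontrivial show ?thesis by simp
  qed
qed

text \<open>
  In a reduced ring \<open>ab = 0\<close> gives \<open>(ba)\<^sup>2 = 0\<close>, so \<open>ba = 0\<close>, so \<open>(arb)\<^sup>2 = 0\<close>, so \<open>arb = 0\<close>. Primeness finishes.
\<close>

lemma torsion_free_part_no_zero_divisors:
  assumes N: "subgroup N G" and tf: "torsion_free_group (G\<lparr>carrier := N\<rparr>)"
    and units: "\<And>u. u \<in> Units R \<Longrightarrow> u \<in> graded_part R S N \<Longrightarrow> homogeneous G R S u"
    and a: "a \<in> graded_part R S N" and b: "b \<in> graded_part R S N" and ab: "a \<otimes>\<^bsub>R\<^esub> b = \<zero>\<^bsub>R\<^esub>"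
  shows "a = \<zero>\<^bsub>R\<^esub> \<or> b = \<zero>\<^bsub>R\<^esub>"
proof (rule torsion_free_part_prime[OF N tf a b])
  note iff = graded_part_iff[OF subgroup.subset[OF N]]
  have c: "a \<in> carrier R" "b \<in> carrier R" using a b iff by auto
  have reduced: "z = \<zero>\<^bsub>R\<^esub>" if "z \<in> graded_part R S N" "z \<otimes>\<^bsub>R\<^esub> z = \<zero>\<^bsub>R\<^esub>" for z
    using torsion_free_part_reduced[OF N tf _ that] units by blast
  have "(b \<otimes>\<^bsub>R\<^esub> a) \<otimes>\<^bsub>R\<^esub> (b \<otimes>\<^bsub>R\<^esub> a) = b \<otimes>\<^bsub>R\<^esub> (a \<otimes>\<^bsub>R\<^esub> b) \<otimes>\<^bsub>R\<^esub> a"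
    using c by (simp add: R.m_assoc)
  then have "(b \<otimes>\<^bsub>R\<^esub> a) \<otimes>\<^bsub>R\<^esub> (b \<otimes>\<^bsub>R\<^esub> a) = \<zero>\<^bsub>R\<^esub>" using c ab by simp
  then have ba: "b \<otimes>\<^bsub>R\<^esub> a = \<zero>\<^bsub>R\<^esub>" using reduced[OF graded_part_mult[OF N b a]] by blast
  fix x r assume x: "x \<in> N" and r: "r \<in> S x"
  have xc: "x \<in> carrier G" using x subgroup.mem_carrier[OF N] by simp
  have rc: "r \<in> carrier R" by (rule homogeneous_closed[OF xc r])
  have rN: "r \<in> graded_part R S N"
    using support_of_homogeneous[OF xc r] x rc iff by auto
  have "(a \<otimes>\<^bsub>R\<^esub> r \<otimes>\<^bsub>R\<^esub> b) \<otimes>\<^bsub>R\<^esub> (a \<otimes>\<^bsub>R\<^esub> r \<otimes>\<^bsub>R\<^esub> b) = a \<otimes>\<^bsub>R\<^esub> r \<otimes>\<^bsub>R\<^esub> (b \<otimes>\<^bsub>R\<^esub> a) \<otimes>\<^bsub>R\<^esub> (r \<otimes>\<^bsub>R\<^esub> b)"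
    using c rc by (simp add: R.m_assoc)
  then have "(a \<otimes>\<^bsub>R\<^esub> r \<otimes>\<^bsub>R\<^esub> b) \<otimes>\<^bsub>R\<^esub> (a \<otimes>\<^bsub>R\<^esub> r \<otimes>\<^bsub>R\<^esub> b) = \<zero>\<^bsub>R\<^esub>" using c rc ba by simp
  then show "a \<otimes>\<^bsub>R\<^esub> r \<otimes>\<^bsub>R\<^esub> b = \<zero>\<^bsub>R\<^esub>"
    using reduced[OF graded_part_mult[OF N graded_part_mult[OF N a rN] b]] by blast
qed

section \<open>The grading by cosets\<close>

text \<open>
  Multiplying \<open>a\<close> from the left by a suitable homogeneous element of degree \<open>inv g\<close>, and \<open>b\<close> from the right by
  one of degree \<open>inv h\<close>, where \<open>g\<close> and \<open>h\<close> are degrees in their supports, brings both into the part graded by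
  \<open>N\<close> without annihilating them.
\<close>

lemma coset_homogeneous_mult_nonzero:
  assumes N: "N \<lhd> G"
    and nzd: "\<forall>a\<in>graded_part R S N. \<forall>b\<in>graded_part R S N.
      a \<otimes>\<^bsub>R\<^esub> b = \<zero>\<^bsub>R\<^esub> \<longrightarrow> a = \<zero>\<^bsub>R\<^esub> \<or> b = \<zero>\<^bsub>R\<^esub>"
    and C: "C \<in> rcosets\<^bsub>G\<^esub> N" and D: "D \<in> rcosets\<^bsub>G\<^esub> N"
    and a: "a \<in> carrier R" "support a \<subseteq> C" "a \<noteq> \<zero>\<^bsub>R\<^esub>"
    and b: "b \<in> carrier R" "support b \<subseteq> D" "b \<noteq> \<zero>\<^bsub>R\<^esub>"
  shows "a \<otimes>\<^bsub>R\<^esub> b \<noteq> \<zero>\<^bsub>R\<^esub>"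
proof
  assume ab: "a \<otimes>\<^bsub>R\<^esub> b = \<zero>\<^bsub>R\<^esub>"
  interpret N: normal N G by (rule N)
  have Nc: "N \<subseteq> carrier G" by (rule N.subset)
  note iff = graded_part_iff[OF Nc]
  have same: "\<exists>n\<in>N. g' = n \<otimes>\<^bsub>G\<^esub> g"
    if E: "E \<in> rcosets\<^bsub>G\<^esub> N" and g: "g \<in> E" and g': "g' \<in> E" for E g g'
  proof -
    obtain c where "c \<in> carrier G" "E = N #>\<^bsub>G\<^esub> c" using E by (auto simp: RCOSETS_def)
    then have "E = N #>\<^bsub>G\<^esub> g" using G.repr_independence[OF _ _ N.subgroup_axioms] g by metis
    with g' show ?thesis by (auto simp: r_coset_def)
  qed
  obtain g where g: "g \<in> support a" using support_empty_iff[OF a(1)] a(3) by auto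
  obtain h where h: "h \<in> support b" using support_empty_iff[OF b(1)] b(3) by auto
  have gc: "g \<in> carrier G" "component a g \<noteq> \<zero>\<^bsub>R\<^esub>" and hc: "h \<in> carrier G" "component b h \<noteq> \<zero>\<^bsub>R\<^esub>"
    using g h by (auto simp: support_def)
  obtain s where s: "s \<in> S (inv\<^bsub>G\<^esub> g)" "s \<otimes>\<^bsub>R\<^esub> component a g \<noteq> \<zero>\<^bsub>R\<^esub>"
    by (rule nonzero_left_multiple[OF gc(1) component_homogeneous[OF a(1) gc(1)] gc(2)])
  obtain t where t: "t \<in> S (inv\<^bsub>G\<^esub> h)" "component b h \<otimes>\<^bsub>R\<^esub> t \<noteq> \<zero>\<^bsub>R\<^esub>"
    by (rule nonzero_right_multiple[OF hc(1) component_homogeneous[OF b(1) hc(1)] hc(2)])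
  have ig: "inv\<^bsub>G\<^esub> g \<in> carrier G" and ih: "inv\<^bsub>G\<^esub> h \<in> carrier G" using gc hc by auto
  have st: "s \<in> carrier R" "t \<in> carrier R"
    using homogeneous_closed[OF ig s(1)] homogeneous_closed[OF ih t(1)] .
  have "support (s \<otimes>\<^bsub>R\<^esub> a) \<subseteq> N"
  proof
    fix k assume "k \<in> support (s \<otimes>\<^bsub>R\<^esub> a)"
    then obtain g0 g' where "g0 \<in> support s" and g': "g' \<in> support a" and "k = g0 \<otimes>\<^bsub>G\<^esub> g'"
      by (rule support_mult[OF st(1) a(1)])
    then have k: "k = inv\<^bsub>G\<^esub> g \<otimes>\<^bsub>G\<^esub> g'" using support_of_homogeneous[OF ig s(1)] by auto
    obtain n where "n \<in> N" "g' = n \<otimes>\<^bsub>G\<^esub> g" using same[OF C, of g g'] g g' a(2) by auto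
    then show "k \<in> N" using N.inv_op_closed1[OF gc(1)] gc(1) Nc by (auto simp: k G.m_assoc subset_iff)
  qed
  then have sa: "s \<otimes>\<^bsub>R\<^esub> a \<in> graded_part R S N" using iff st a by simp
  have "support (b \<otimes>\<^bsub>R\<^esub> t) \<subseteq> N"
  proof
    fix k assume "k \<in> support (b \<otimes>\<^bsub>R\<^esub> t)"
    then obtain h' h0 where h': "h' \<in> support b" and "h0 \<in> support t" "k = h' \<otimes>\<^bsub>G\<^esub> h0"
      by (rule support_mult[OF b(1) st(2)])
    then have k: "k = h' \<otimes>\<^bsub>G\<^esub> inv\<^bsub>G\<^esub> h" using support_of_homogeneous[OF ih t(1)] by auto
    obtain n where "n \<in> N" "h' = n \<otimes>\<^bsub>G\<^esub> h" using same[OF D, of h h'] h h' b(2) by auto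
    then show "k \<in> N" using hc(1) Nc by (auto simp: k G.m_assoc subset_iff)
  qed
  then have bt: "b \<otimes>\<^bsub>R\<^esub> t \<in> graded_part R S N" using iff st b by simp
  have "component (s \<otimes>\<^bsub>R\<^esub> a) (inv\<^bsub>G\<^esub> g \<otimes>\<^bsub>G\<^esub> g) \<noteq> \<zero>\<^bsub>R\<^esub>"
    using component_product_homogeneous_left[OF a(1) s(1) ig gc(1)] s(2) by simp
  then have sa0: "s \<otimes>\<^bsub>R\<^esub> a \<noteq> \<zero>\<^bsub>R\<^esub>" using component_zero gc by auto
  have "component (b \<otimes>\<^bsub>R\<^esub> t) (h \<otimes>\<^bsub>G\<^esub> inv\<^bsub>G\<^esub> h) \<noteq> \<zero>\<^bsub>R\<^esub>"
    using component_product_homogeneous_right[OF b(1) t(1) ih hc(1)] t(2) by simp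
  then have bt0: "b \<otimes>\<^bsub>R\<^esub> t \<noteq> \<zero>\<^bsub>R\<^esub>" using component_zero hc by auto
  have "(s \<otimes>\<^bsub>R\<^esub> a) \<otimes>\<^bsub>R\<^esub> (b \<otimes>\<^bsub>R\<^esub> t) = s \<otimes>\<^bsub>R\<^esub> (a \<otimes>\<^bsub>R\<^esub> b) \<otimes>\<^bsub>R\<^esub> t"
    using a b st by (simp add: R.m_assoc)
  also have "\<dots> = \<zero>\<^bsub>R\<^esub>" using ab st by simp
  finally show False using nzd sa bt sa0 bt0 by blast
qed

text \<open>
  In the degrees belonging to the coset \<open>C D\<close>, the product \<open>a b\<close> agrees with the product of the parts of \<open>a\<close> and \<open>b\<close>
  in \<open>C\<close> and \<open>D\<close>. That product is not zero.
\<close>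

lemma coset_unique_factors_support:
  assumes N: "N \<lhd> G"
    and nzd: "\<forall>a\<in>graded_part R S N. \<forall>b\<in>graded_part R S N.
      a \<otimes>\<^bsub>R\<^esub> b = \<zero>\<^bsub>R\<^esub> \<longrightarrow> a = \<zero>\<^bsub>R\<^esub> \<or> b = \<zero>\<^bsub>R\<^esub>"
    and a: "a \<in> carrier R" and b: "b \<in> carrier R"
    and CD: "unique_factors (G Mod N) ((\<lambda>g. N #>\<^bsub>G\<^esub> g) ` support a) ((\<lambda>h. N #>\<^bsub>G\<^esub> h) ` support b) C D"
  obtains k where "k \<in> support (a \<otimes>\<^bsub>R\<^esub> b)" "N #>\<^bsub>G\<^esub> k = C <#>\<^bsub>G\<^esub> D"
proof -
  interpret N: normal N G by (rule N)
  have Nc: "N \<subseteq> carrier G" by (rule N.subset)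
  obtain g0 where g0: "g0 \<in> support a" "C = N #>\<^bsub>G\<^esub> g0" using CD by (auto simp: unique_factors_def)
  obtain h0 where h0: "h0 \<in> support b" "D = N #>\<^bsub>G\<^esub> h0" using CD by (auto simp: unique_factors_def)
  have c: "g0 \<in> carrier G" "h0 \<in> carrier G" using g0 h0 support_subset by auto
  have C: "C \<in> rcosets\<^bsub>G\<^esub> N" and D: "D \<in> rcosets\<^bsub>G\<^esub> N"
    using g0 h0 c G.rcosetsI[OF Nc] by auto
  have coset_mem: "N #>\<^bsub>G\<^esub> g = N #>\<^bsub>G\<^esub> g'" if "g \<in> N #>\<^bsub>G\<^esub> g'" "g' \<in> carrier G" for g g'
    using G.repr_independence[OF that N.subgroup_axioms] by simp
  define a' where "a' = restriction C a"
  define b' where "b' = restriction D b"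
  have a': "a' \<in> carrier R" "support a' = support a \<inter> C"
    and b': "b' \<in> carrier R" "support b' = support b \<inter> D"
    using restriction a b by (simp_all add: a'_def b'_def)
  have "g0 \<in> support a'" "h0 \<in> support b'"
    using a' b' g0 h0 G.rcos_self[OF _ N.subgroup_axioms] c by auto
  then have "a' \<noteq> \<zero>\<^bsub>R\<^esub>" "b' \<noteq> \<zero>\<^bsub>R\<^esub>"
    using support_empty_iff[OF a'(1)] support_empty_iff[OF b'(1)] by auto
  then have "a' \<otimes>\<^bsub>R\<^esub> b' \<noteq> \<zero>\<^bsub>R\<^esub>"
    using coset_homogeneous_mult_nonzero[OF N nzd C D] a' b' by simp
  then obtain k where k: "k \<in> support (a' \<otimes>\<^bsub>R\<^esub> b')"
    using support_empty_iff[OF R.m_closed[OF a'(1) b'(1)]] by auto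
  then obtain g h where gh: "g \<in> support a'" "h \<in> support b'" "k = g \<otimes>\<^bsub>G\<^esub> h"
    by (rule support_mult[OF a'(1) b'(1)])
  have kc: "k \<in> carrier G" using k support_subset by auto
  have "N #>\<^bsub>G\<^esub> g = C" "N #>\<^bsub>G\<^esub> h = D" using gh a' b' g0 h0 coset_mem c by auto
  then have kCD: "N #>\<^bsub>G\<^esub> k = C <#>\<^bsub>G\<^esub> D"
    using N.rcos_sum[of g h] gh support_subset by auto
  have comp: "component a' g = component a g \<and> component b' h = component b h"
    if "g \<in> support a" "h \<in> support b" "g \<otimes>\<^bsub>G\<^esub> h = k" for g h
  proof -
    have c': "g \<in> carrier G" "h \<in> carrier G" using that support_subset by auto
    then have "(N #>\<^bsub>G\<^esub> g) <#>\<^bsub>G\<^esub> (N #>\<^bsub>G\<^esub> h) = C <#>\<^bsub>G\<^esub> D"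
      using N.rcos_sum[OF c'] that(3) kCD by simp
    then have "N #>\<^bsub>G\<^esub> g = C" "N #>\<^bsub>G\<^esub> h = D" using CD that by (auto simp: unique_factors_def)
    then have "g \<in> C" "h \<in> D" using G.rcos_self[OF _ N.subgroup_axioms] c' by auto
    then show ?thesis using restriction(2)[OF a] restriction(2)[OF b] c' by (simp add: a'_def b'_def)
  qed
  have fin: "finite (support a)" "finite (support b)" using finite_support a b by auto
  have "component (a' \<otimes>\<^bsub>R\<^esub> b') k = component (a \<otimes>\<^bsub>R\<^esub> b) k"
    unfolding component_product[OF a b fin(1) subset_refl support_subset fin(2) subset_refl support_subset kc]
    by (subst component_product[OF a'(1) b'(1) fin(1) _ support_subset fin(2) _ support_subset kc])
      (use a' b' comp a b component_closed in
        \<open>auto simp: support_def intro!: R.finsum_cong' R.finsum_closed\<close>)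
  then have "k \<in> support (a \<otimes>\<^bsub>R\<^esub> b)" using k kc by (simp add: support_def)
  with kCD show thesis by (rule that[rotated])
qed

end

text \<open>
  For units \<open>u\<close> and \<open>v = u\<inverse>\<close>, every pair of cosets with a unique product multiplies to \<open>N\<close>, the coset of the
  degree of \<open>\<one>\<close>. Uniqueness then allows one such pair only, so that \<open>two_unique_products\<close> confines
  \<open>u\<close> to a single coset.
\<close>

theorem proposition7p3:
  fixes G :: "('g, 'm) monoid_scheme"
    and R :: "('r, 'k) ring_scheme"
    and S :: "'g \<Rightarrow> 'r set"
    and N :: "'g set"
  assumes "graded_ring G R S"
    and "nondegenerate_grading G R S"
    and "N \<lhd> G"
    and "nc_domain (R\<lparr>carrier := S \<one>\<^bsub>G\<^esub>\<rparr>)"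
  shows "(nc_domain (R\<lparr>carrier := graded_part R S N\<rparr>) \<and> unique_product_group (G Mod N)
            \<longrightarrow> nc_domain R)
       \<and> (torsion_free_group (G\<lparr>carrier := N\<rparr>) \<and> unique_product_group (G Mod N)
            \<and> (\<forall>u\<in>Units R. \<forall>g\<in>carrier G.
                  u \<in> graded_part R S (g <#\<^bsub>G\<^esub> N) \<longrightarrow> homogeneous G R S u)
            \<longrightarrow> (\<forall>u\<in>Units R. homogeneous G R S u))"
proof -
  interpret nondegenerate_domain_grading G R S
    using assms by (intro nondegenerate_domain_grading.intro nondegenerate_domain_grading_axioms.intro)
  interpret N: normal N G by (rule assms(3))
  have Nc: "N \<subseteq> carrier G" by (rule N.subset)
  let ?cosets = "\<lambda>r. (\<lambda>g. N #>\<^bsub>G\<^esub> g) ` support r"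
  let ?no_zero_divisors = "\<forall>a\<in>graded_part R S N. \<forall>b\<in>graded_part R S N.
      a \<otimes>\<^bsub>R\<^esub> b = \<zero>\<^bsub>R\<^esub> \<longrightarrow> a = \<zero>\<^bsub>R\<^esub> \<or> b = \<zero>\<^bsub>R\<^esub>"
  have cosets: "?cosets r \<subseteq> carrier (G Mod N)" "finite (?cosets r)" "r \<noteq> \<zero>\<^bsub>R\<^esub> \<Longrightarrow> ?cosets r \<noteq> {}"
    if "r \<in> carrier R" for r
    using that support_subset[of r] finite_support support_empty_iff[OF that]
    by (auto simp: carrier_FactGroup)
  have unique: "\<exists>C D. unique_factors (G Mod N) (?cosets a) (?cosets b) C D"
    if up: "unique_product_group (G Mod N)"
      and ab: "a \<in> carrier R" "b \<in> carrier R" "a \<noteq> \<zero>\<^bsub>R\<^esub>" "b \<noteq> \<zero>\<^bsub>R\<^esub>" for a b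
    by (rule unique_product_group_unique_factors[OF up, of "?cosets a" "?cosets b"])
      (use cosets ab in auto)
  have domain: "nc_domain R"
    if dom: "nc_domain (R\<lparr>carrier := graded_part R S N\<rparr>)" and up: "unique_product_group (G Mod N)"
  proof -
    have nzd: ?no_zero_divisors
      using nc_domain.no_zero_divisors[OF dom] by auto
    have "a \<otimes>\<^bsub>R\<^esub> b \<noteq> \<zero>\<^bsub>R\<^esub>"
      if ab: "a \<in> carrier R" "b \<in> carrier R" "a \<noteq> \<zero>\<^bsub>R\<^esub>" "b \<noteq> \<zero>\<^bsub>R\<^esub>" for a b
    proof -
      obtain C D where CD: "unique_factors (G Mod N) (?cosets a) (?cosets b) C D"
        using unique[OF up ab] by (elim exE)
      obtain k where "k \<in> support (a \<otimes>\<^bsub>R\<^esub> b)"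
        by (rule coset_unique_factors_support[OF assms(3) nzd ab(1,2) CD])
      then show ?thesis using support_empty_iff[OF R.m_closed[OF ab(1,2)]] by auto
    qed
    moreover have "carrier R \<noteq> {\<zero>\<^bsub>R\<^esub>}" using nontrivial by auto
    ultimately show ?thesis
      by unfold_locales (auto simp: R.m_assoc R.l_distr R.r_distr)
  qed
  have units: "homogeneous G R S u"
    if tf: "torsion_free_group (G\<lparr>carrier := N\<rparr>)" and up: "unique_product_group (G Mod N)"
      and coset_units: "\<forall>u\<in>Units R. \<forall>g\<in>carrier G.
        u \<in> graded_part R S (g <#\<^bsub>G\<^esub> N) \<longrightarrow> homogeneous G R S u"
      and u: "u \<in> Units R" for u
  proof -
    have lcoset_one: "\<one>\<^bsub>G\<^esub> <#\<^bsub>G\<^esub> N = N" by (rule G.lcos_mult_one[OF Nc])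
    have "homogeneous G R S w" if "w \<in> Units R" "w \<in> graded_part R S N" for w
      using coset_units that lcoset_one G.one_closed by metis
    then have nzd: ?no_zero_divisors
      using torsion_free_part_no_zero_divisors[OF N.subgroup_axioms tf] by blast
    define v where "v = inv\<^bsub>R\<^esub> u"
    have uv: "u \<in> carrier R" "v \<in> carrier R" "u \<otimes>\<^bsub>R\<^esub> v = \<one>\<^bsub>R\<^esub>"
      using u by (auto simp: v_def)
    have nz: "u \<noteq> \<zero>\<^bsub>R\<^esub>" "v \<noteq> \<zero>\<^bsub>R\<^esub>" using uv nontrivial by auto
    have product_one: "C \<otimes>\<^bsub>G Mod N\<^esub> D = N"
      if CD: "unique_factors (G Mod N) (?cosets u) (?cosets v) C D" for C D
    proof -
      obtain k where "k \<in> support (u \<otimes>\<^bsub>R\<^esub> v)" "N #>\<^bsub>G\<^esub> k = C <#>\<^bsub>G\<^esub> D"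
        by (rule coset_unique_factors_support[OF assms(3) nzd uv(1,2) CD])
      then show ?thesis using support_one uv(3) G.coset_mult_one[OF Nc] by simp
    qed
    interpret Q: group "G Mod N" by (rule N.factorgroup_is_group)
    obtain C D where CD: "unique_factors (G Mod N) (?cosets u) (?cosets v) C D"
      using unique[OF up uv(1,2) nz] by (elim exE)
    have single: "E = C" if E: "E \<in> ?cosets u" for E
    proof (rule ccontr)
      assume "E \<noteq> C"
      moreover have "C \<in> ?cosets u" using CD by (simp add: unique_factors_def)
      ultimately have large: "(\<exists>x\<in>?cosets u. \<exists>y\<in>?cosets u. x \<noteq> y)
          \<or> (\<exists>x\<in>?cosets v. \<exists>y\<in>?cosets v. x \<noteq> y)"
        using E by blast
      obtain C' D' where CD': "unique_factors (G Mod N) (?cosets u) (?cosets v) C' D'"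
        and ne: "(C', D') \<noteq> (C, D)"
        by (rule Q.two_unique_products[OF up cosets(1,2)[OF uv(1)] cosets(1,2)[OF uv(2)] large CD])
      have "C' \<otimes>\<^bsub>G Mod N\<^esub> D' = C \<otimes>\<^bsub>G Mod N\<^esub> D"
        using product_one[OF CD] product_one[OF CD'] by simp
      moreover have "C' \<in> ?cosets u" "D' \<in> ?cosets v" using CD' by (simp_all add: unique_factors_def)
      ultimately have "C' = C \<and> D' = D" using CD unfolding unique_factors_def by blast
      with ne show False by simp
    qed
    obtain g where g: "g \<in> support u" using nz support_empty_iff[OF uv(1)] by auto
    have gc: "g \<in> carrier G" using g support_subset by auto
    have "support u \<subseteq> g <#\<^bsub>G\<^esub> N"
    proof
      fix h assume h: "h \<in> support u"
      have hc: "h \<in> carrier G" using h support_subset by auto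
      have "N #>\<^bsub>G\<^esub> h = N #>\<^bsub>G\<^esub> g" using single[of "N #>\<^bsub>G\<^esub> g"] single[of "N #>\<^bsub>G\<^esub> h"] g h by simp
      then have "h \<in> N #>\<^bsub>G\<^esub> g" using G.rcos_self[OF hc N.subgroup_axioms] by simp
      then show "h \<in> g <#\<^bsub>G\<^esub> N" using N.coset_eq gc by simp
    qed
    then have "u \<in> graded_part R S (g <#\<^bsub>G\<^esub> N)"
      using graded_part_iff[OF G.l_coset_subset_G[OF Nc gc]] uv(1) by simp
    then show ?thesis using coset_units u gc by blast
  qed
  show ?thesis using domain units by blast
qed

end
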